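(* Let $m\ge 2$ and let $G=CK(2m-1)$. Every blocker for the family of simple Hamiltonian paths of $G$ consists of exactly $m$ edges lying in $m$ pairwise distinct, boundary-consecutive directions (i.e., the directions of the $m$ edges of some boundary path of length $m$), and, up to a cyclic rotation $x\mapsto x+k$ of the vertex labels ($0\le k\le 2m-2$), it is a set of Class A or a set of Class B. Conversely, every set of Class A and every set of Class B is a blocker for the simple Hamiltonian paths of $G$.
   Context: $CK(2m-1)$ is the complete convex geometric graph on $2m-1$ points in convex position in the plane (vertices of a convex polygon $P$), labelled clockwise $0,1,\dots,2m-2$ and regarded as elements of $\mathbb{Z}_{2m-1}$; its edges are all segments $[i,j]$, $i\ne j$. The boundary edges are $[i,i+1]$ (indices mod $2m-1$). The direction of an edge $[i,j]$ is $i+j \pmod{2m-1}$; two edges are parallel if they have the same direction. Two directions are boundary-consecutive if they differ by $2 \pmod{2m-1}$ (they contain consecutive boundary edges). The distance between vertices $i,j$ is $\min(|i-j|,(2m-1)-|i-j|)$. A simple Hamiltonian path (SHP) is a path in $G$ through all vertices whose edges pairwise do not cross. A blocker for SHPs is a set of edges of smallest possible size having an edge in common with every SHP. All vertex indices below are taken mod $2m-1$. Class A: sets consisting of the following edges, for integers $\alpha,\delta\ge 0$ with $\alpha+\delta\le m-2$: (1) all edges of the boundary path $\langle \alpha,\alpha+1,\dots,m-\delta\rangle$; (2) the edges $[i-1-\epsilon_i,\,i+\epsilon_i]$, $1\le i\le\alpha$, where $\epsilon_1>\epsilon_2>\dots>\epsilon_\alpha>0$ and $\alpha-i+1\le\epsilon_i\le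 m-\delta-i-1$; (3) the edges $[m-j-\xi_j,\,m-j+1+\xi_j]$, $1\le j\le\delta$, where $\xi_1>\xi_2>\dots>\xi_\delta>0$ and $\delta+1-j\le\xi_j\le m-j-\alpha-1$; and in addition $\epsilon_1+\xi_1\le m-2$ (when both $\alpha,\delta>0$). Class B: sets consisting of the following edges, for integers $\alpha,\delta\ge0$, $\beta,\gamma\ge 2$ with $\alpha+\delta\le m-5$ and $\beta+\gamma=m-\alpha-\delta-1$: (1)–(2) all edges of the boundary paths $\langle\alpha,\dots,\alpha+\beta\rangle$ and $\langle\alpha+\beta+1,\dots,m-\delta\rangle$; (3) the edge $[\alpha+\beta-\eta,\,\alpha+\beta+1+\eta]$ for some integer $1\le\eta\le\min(\beta-1,\gamma-1)$; (4) the edges $[i-1-\epsilon_i,\,i+\epsilon_i]$, $1\le i\le\alpha$, where $\alpha+\beta-1>\epsilon_1>\epsilon_2>\dots>\epsilon_\alpha>0$; (5) the edges $[m-j-\xi_j,\,m-j+1+\xi_j]$, $1\le j\le\delta$, where $\gamma+\delta-1>\xi_1>\xi_2>\dots>\xi_\delta>0$. *)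

theory Defs
  imports Main
begin

text \<open>The complete convex geometric graph CK(2m-1). Vertices are the integers
  0, ..., 2m-2 (labelled clockwise); an edge is the two-element set of its endpoints.\<close>

definition npts :: "int \<Rightarrow> int" where
  "npts m = 2 * m - 1"

definition verts :: "int \<Rightarrow> int set" where
  "verts m = {0..<npts m}"

definition edge :: "int \<Rightarrow> int \<Rightarrow> int \<Rightarrow> int set" where
  "edge m x y = {x mod npts m, y mod npts m}"

definition edges :: "int \<Rightarrow> int set set" where
  "edges m = {{x, y} | x y. x \<in> verts m \<and> y \<in> verts m \<and> x \<noteq> y}"

text \<open>Two segments between points in convex position (labelled in cyclic order)
  cross iff their endpoints are pairwise distinct and strictly interleave.\<close>
definition crosses :: "int set \<Rightarrow> int set \<Rightarrow> bool" where
  "crosses e f \<longleftrightarrow>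
     (\<exists>a b c d. e = {a, b} \<and> f = {c, d} \<and> a < c \<and> c < b \<and> b < d) \<or>
     (\<exists>a b c d. f = {a, b} \<and> e = {c, d} \<and> a < c \<and> c < b \<and> b < d)"

definition path_edge :: "int list \<Rightarrow> nat \<Rightarrow> int set" where
  "path_edge p i = {p ! i, p ! (i + 1)}"

definition is_SHP :: "int \<Rightarrow> int list \<Rightarrow> bool" where
  "is_SHP m p \<longleftrightarrow> distinct p \<and> set p = verts m \<and>
     (\<forall>i j. i + 1 < length p \<and> j + 1 < length p \<longrightarrow>
        \<not> crosses (path_edge p i) (path_edge p j))"

definition hits_all_SHP :: "int \<Rightarrow> int set set \<Rightarrow> bool" where
  "hits_all_SHP m B \<longleftrightarrow>
     (\<forall>p. is_SHP m p \<longrightarrow> (\<exists>i. i + 1 < length p \<and> path_edge p i \<in> B))"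

definition is_blocker :: "int \<Rightarrow> int set set \<Rightarrow> bool" where
  "is_blocker m B \<longleftrightarrow> B \<subseteq> edges m \<and> hits_all_SHP m B \<and>
     (\<forall>B'. B' \<subseteq> edges m \<and> hits_all_SHP m B' \<longrightarrow> card B \<le> card B')"

definition direction :: "int \<Rightarrow> int set \<Rightarrow> int" where
  "direction m e = (\<Sum>e) mod npts m"

definition rotate_edges :: "int \<Rightarrow> int \<Rightarrow> int set set \<Rightarrow> int set set" where
  "rotate_edges m k B = (\<lambda>e. (\<lambda>x. (x + k) mod npts m) ` e) ` B"

definition bpath :: "int \<Rightarrow> int \<Rightarrow> int \<Rightarrow> int set set" where
  "bpath m a b = {edge m t (t + 1) | t. a \<le> t \<and> t < b}"

definition classA :: "int \<Rightarrow> int set set set" where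
  "classA m = {S. \<exists>(\<alpha>::int) (\<delta>::int) (\<epsilon>::int \<Rightarrow> int) (\<xi>::int \<Rightarrow> int).
     0 \<le> \<alpha> \<and> 0 \<le> \<delta> \<and> \<alpha> + \<delta> \<le> m - 2 \<and>
     (\<forall>i. 1 \<le> i \<and> i < \<alpha> \<longrightarrow> \<epsilon> i > \<epsilon> (i + 1)) \<and>
     (\<forall>i. 1 \<le> i \<and> i \<le> \<alpha> \<longrightarrow> 0 < \<epsilon> i \<and> \<alpha> - i + 1 \<le> \<epsilon> i \<and> \<epsilon> i \<le> m - \<delta> - i - 1) \<and>
     (\<forall>j. 1 \<le> j \<and> j < \<delta> \<longrightarrow> \<xi> j > \<xi> (j + 1)) \<and>
     (\<forall>j. 1 \<le> j \<and> j \<le> \<delta> \<longrightarrow> 0 < \<xi> j \<and> \<delta> + 1 - j \<le> \<xi> j \<and> \<xi> j \<le> m - j - \<alpha> - 1) \<and>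
     (0 < \<alpha> \<and> 0 < \<delta> \<longrightarrow> \<epsilon> 1 + \<xi> 1 \<le> m - 2) \<and>
     S = bpath m \<alpha> (m - \<delta>)
         \<union> {edge m (i - 1 - \<epsilon> i) (i + \<epsilon> i) | i. 1 \<le> i \<and> i \<le> \<alpha>}
         \<union> {edge m (m - j - \<xi> j) (m - j + 1 + \<xi> j) | j. 1 \<le> j \<and> j \<le> \<delta>}}"

definition classB :: "int \<Rightarrow> int set set set" where
  "classB m = {S. \<exists>(\<alpha>::int) (\<delta>::int) (\<beta>::int) (\<gamma>::int) (\<eta>::int)
                   (\<epsilon>::int \<Rightarrow> int) (\<xi>::int \<Rightarrow> int).
     0 \<le> \<alpha> \<and> 0 \<le> \<delta> \<and> 2 \<le> \<beta> \<and> 2 \<le> \<gamma> \<and> \<alpha> + \<delta> \<le> m - 5 \<and>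
     \<beta> + \<gamma> = m - \<alpha> - \<delta> - 1 \<and>
     1 \<le> \<eta> \<and> \<eta> \<le> min (\<beta> - 1) (\<gamma> - 1) \<and>
     (\<forall>i. 1 \<le> i \<and> i < \<alpha> \<longrightarrow> \<epsilon> i > \<epsilon> (i + 1)) \<and>
     (\<forall>i. 1 \<le> i \<and> i \<le> \<alpha> \<longrightarrow> 0 < \<epsilon> i \<and> \<epsilon> i < \<alpha> + \<beta> - 1) \<and>
     (\<forall>j. 1 \<le> j \<and> j < \<delta> \<longrightarrow> \<xi> j > \<xi> (j + 1)) \<and>
     (\<forall>j. 1 \<le> j \<and> j \<le> \<delta> \<longrightarrow> 0 < \<xi> j \<and> \<xi> j < \<gamma> + \<delta> - 1) \<and>
     S = bpath m \<alpha> (\<alpha> + \<beta>) \<union> bpath m (\<alpha> + \<beta> + 1) (m - \<delta>)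
         \<union> {edge m (\<alpha> + \<beta> - \<eta>) (\<alpha> + \<beta> + 1 + \<eta>)}
         \<union> {edge m (i - 1 - \<epsilon> i) (i + \<epsilon> i) | i. 1 \<le> i \<and> i \<le> \<alpha>}
         \<union> {edge m (m - j - \<xi> j) (m - j + 1 + \<xi> j) | j. 1 \<le> j \<and> j \<le> \<delta>}}"

end

theory Submission
  imports Defs
begin

text \<open>Write \<open>n = 2m - 1\<close>. A simple Hamiltonian path visits the vertices so that the visited set is always
  a cyclic interval, hence it is coded by the moves of the right end of this interval. The zigzag
  paths use exactly the edges of two consecutive directions, so the directions of a hitting set form
  a vertex cover of the cycle on \<open>\<int>\<^sub>n\<close>. This gives the lower bound \<open>m\<close> and, in the case of equality, up to
  rotation one edge \<open>[t - s t, t + 1 + s t]\<close> for each \<open>0 \<le> t < m\<close>.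

  Zigzag paths that change their directions once or twice show that \<open>s\<close> is strictly decreasing up to
  its first zero, strictly increasing from its last zero, has at most one nonzero value in between, and
  satisfies the inequalities of class A or class B.

  Conversely, let a path avoid such a set. The zeros of \<open>s\<close> are boundary edges in the set (the spine). If
  no inner vertex of the spine is an end of the path, the spine is visited in order, and the path
  turns at each of its vertices. Then the direction of the edges used at the spine never increases
  along the spine. The edges with \<open>t < \<alpha>\<close> force it to drop below 1 and the edges with \<open>t \<ge> m - \<delta>\<close>
  require it to stay above 0 for too long. In class B the boundary edge missing from the spine allows
  a single increase, which is not enough, and a path that starts in the gap is forced to zigzag into
  the edge above the gap.\<close>

section \<open>Simple Hamiltonian paths as growing intervals\<close>

text \<open>The vertices visited by the first \<open>k\<close> steps of a simple Hamiltonian path form a cyclic interval.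
  Lifted to the integers, it is \<open>[h k - k + 1, h k]\<close>; step \<open>k\<close> extends it on the right if
  \<open>h (k + 1) = h k + 1\<close> and on the left if \<open>h (k + 1) = h k\<close>.\<close>
definition walk :: "(nat \<Rightarrow> int) \<Rightarrow> bool" where
  "walk h \<longleftrightarrow> (\<forall>k. h (Suc k) = h k \<or> h (Suc k) = h k + 1)"

text \<open>Before step \<open>k\<close> the interval has \<open>k\<close> elements and right end
  \<open>h k\<close>, so its free neighbours are \<open>h k - k\<close> and \<open>h k + 1\<close>.
  The values are integers, not residues, so that cyclic position becomes linear order.\<close>

definition wvert :: "(nat \<Rightarrow> int) \<Rightarrow> nat \<Rightarrow> int" where
  "wvert h k = (if h (Suc k) = h k then h k - int k else h k + 1)"

definition wpath :: "int \<Rightarrow> (nat \<Rightarrow> int) \<Rightarrow> int list" where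
  "wpath m h = map (\<lambda>k. wvert h k mod npts m) [0..<nat (npts m)]"

lemma walkD: "walk h \<Longrightarrow> h (Suc k) = h k \<or> h (Suc k) = h k + 1"
  by (simp add: walk_def)

lemma walk_mono:
  assumes "walk h" "j \<le> k"
  shows "h j \<le> h k" "h k - int k \<le> h j - int j"
proof -
  have "h j \<le> h k \<and> h k - int k \<le> h j - int j"
    using assms(2)
  proof (induction k rule: dec_induct)
    case (step k)
    then show ?case using walkD[OF assms(1), of k] by auto
  qed simp
  then show "h j \<le> h k" "h k - int k \<le> h j - int j" by auto
qed

lemma wvert_image:
  assumes "walk h"
  shows "wvert h ` {..<k} = {h k - int k + 1 .. h k}"
proof (induction k)
  case (Suc k)
  have "wvert h ` {..<Suc k} = insert (wvert h k) {h k - int k + 1 .. h k}"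
    using Suc by (simp add: lessThan_Suc)
  also have "\<dots> = {h (Suc k) - int (Suc k) + 1 .. h (Suc k)}"
    using walkD[OF assms, of k] walk_mono[OF assms, of 0 k] by (auto simp: wvert_def)
  finally show ?case .
qed simp

lemma wvert_bounds:
  assumes "walk h" "j < k"
  shows "h k - int k + 1 \<le> wvert h j" "wvert h j \<le> h k"
  using wvert_image[OF assms(1), of k] assms(2) by auto

lemma wvert_new:
  assumes "walk h"
  shows "wvert h k = h k - int k \<and> h (Suc k) = h k \<or> wvert h k = h k + 1 \<and> h (Suc k) = h k + 1"
  using walkD[OF assms, of k] by (auto simp: wvert_def)

lemma mod_eq_imp_eq:
  fixes x y n :: int
  assumes "x mod n = y mod n" "\<bar>x - y\<bar> < n"
  shows "x = y"
proof -
  have "n dvd x - y" using assms(1) by (simp add: mod_eq_dvd_iff)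
  then show ?thesis using assms(2) dvd_imp_le_int[of "x - y" n] by force
qed

lemma wvert_mod_inj:
  assumes "walk h" "i < j" "int j < n"
  shows "wvert h i mod n \<noteq> wvert h j mod n"
proof
  assume eq: "wvert h i mod n = wvert h j mod n"
  have "\<bar>wvert h i - wvert h j\<bar> < n"
    using wvert_bounds[OF assms(1,2)] wvert_new[OF assms(1), of j] assms(3) by auto
  with eq have "wvert h i = wvert h j" by (rule mod_eq_imp_eq)
  then show False
    using wvert_bounds[OF assms(1,2)] wvert_new[OF assms(1), of j] by auto
qed

text \<open>On a window of length \<open>n\<close> reduction modulo \<open>n\<close> is a
  translation broken at a single point, so questions about residues become linear
  arithmetic.\<close>

lemma mod_window:
  fixes x L n :: int
  assumes "L \<le> x" "x < L + n"
  shows "x mod n = (if x < n * (L div n) + n then x - n * (L div n) else x - n * (L div n) - n)"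
proof -
  have n: "n > 0" using assms by linarith
  define q where "q = L div n"
  have L: "n * q \<le> L" "L < n * q + n"
    using n pos_mod_bound[OF n, of L] pos_mod_sign[OF n, of L] mult_div_mod_eq[of n L]
    unfolding q_def by linarith+
  show ?thesis
  proof (cases "x < n * q + n")
    case True
    then have "x div n = q"
      using L assms(1) by (intro int_div_pos_eq[of _ _ _ "x - n * q"]) auto
    then show ?thesis using True by (simp add: q_def minus_mult_div_eq_mod[symmetric])
  next
    case False
    then have "x div n = q + 1"
      using L assms(2) by (intro int_div_pos_eq[of _ _ _ "x - n * q - n"]) (auto simp: algebra_simps)
    then show ?thesis using False by (simp add: q_def minus_mult_div_eq_mod[symmetric] algebra_simps)
  qed
qed

section \<open>Crossings of lifted segments\<close>

definition between :: "int \<Rightarrow> int \<Rightarrow> int \<Rightarrow> bool" where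
  "between a b x \<longleftrightarrow> a < x \<and> x < b \<or> b < x \<and> x < a"

lemma crosses_iff_between:
  "crosses {a, b} {c, d} \<longleftrightarrow>
     c \<notin> {a, b} \<and> d \<notin> {a, b} \<and> between a b c \<noteq> between a b d"
proof -
  have ex: "(\<exists>a' b' c' d'. {a, b} = {a', b'} \<and> {c, d} = {c', d'} \<and> a' < c' \<and> c' < b' \<and> b' < d') \<longleftrightarrow>
    (a < c \<and> c < b \<and> b < d) \<or> (b < c \<and> c < a \<and> a < d) \<or>
    (a < d \<and> d < b \<and> b < c) \<or> (b < d \<and> d < a \<and> a < c)" (is "?L \<longleftrightarrow> ?R") for a b c d :: int
  proof
    show "?L \<Longrightarrow> ?R" by (auto simp: doubleton_eq_iff)
    show "?R \<Longrightarrow> ?L" by (elim disjE) (metis insert_commute)+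
  qed
  show ?thesis
    unfolding crosses_def ex between_def insert_iff empty_iff by (smt (verit))
qed

text \<open>Reduction cuts the window once and swaps the two pieces. This is a cyclic rotation of
  the vertices, and interleaving of two pairs survives it.\<close>

lemma crosses_mod_iff:
  fixes n :: int
  assumes "{a, b, c, d} \<subseteq> {L..<L + n}"
  shows "crosses {a mod n, b mod n} {c mod n, d mod n} \<longleftrightarrow> crosses {a, b} {c, d}"
proof -
  define q where "q = n * (L div n)"
  have n: "n > 0" using assms by auto
  have w: "x mod n = (if x < q + n then x - q else x - q - n)" if "x \<in> {a, b, c, d}" for x
    using mod_window[of L x n] assms that unfolding q_def by auto
  have e: "x mod n = y mod n \<longleftrightarrow> x = y" if "x \<in> {a, b, c, d}" "y \<in> {a, b, c, d}" for x y
    using mod_eq_imp_eq[of x n y] assms that by auto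
  \<comment> \<open>The position of \<open>x\<close> relative to \<open>a\<close>, \<open>b\<close>
    flips exactly if one of \<open>a\<close>, \<open>b\<close> lies beyond the cut and the other
    does not. This does not depend on \<open>x\<close>, so \<open>c\<close> and \<open>d\<close>
    flip together.\<close>
  have wrap: "between (a mod n) (b mod n) (x mod n) =
      (between a b x \<noteq> ((a < q + n) \<noteq> (b < q + n)))"
    if "x \<in> {c, d}" "x \<noteq> a" "x \<noteq> b" for x
  proof -
    have r: "a < L + n" "L \<le> a" "b < L + n" "L \<le> b" "x < L + n" "L \<le> x"
      using assms that by auto
    have x: "x mod n = (if x < q + n then x - q else x - q - n)"
      using w that by auto
    show ?thesis
      unfolding between_def x w[of a, simplified] w[of b, simplified]
      using r n that(2,3)
      by (smt (verit))
  qed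
  have "x mod n \<in> {a mod n, b mod n} \<longleftrightarrow> x \<in> {a, b}" if "x \<in> {c, d}" for x
    using e[of x a] e[of x b] that by auto
  then show ?thesis
    unfolding crosses_iff_between using wrap[of c] wrap[of d] by (metis insertCI)
qed


lemma npts_ge_3: "m \<ge> 2 \<Longrightarrow> npts m \<ge> 3"
  by (simp add: npts_def)

lemma length_wpath: "length (wpath m h) = nat (npts m)"
  by (simp add: wpath_def)

lemma wpath_nth: "k < nat (npts m) \<Longrightarrow> wpath m h ! k = wvert h k mod npts m"
  by (simp add: wpath_def)

lemma wpath_edge:
  "k + 1 < nat (npts m) \<Longrightarrow> path_edge (wpath m h) k = edge m (wvert h k) (wvert h (Suc k))"
  by (simp add: path_edge_def edge_def wpath_nth)

lemma crosses_commute: "crosses e f \<longleftrightarrow> crosses f e"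
  by (auto simp: crosses_def)

text \<open>Vertices visited later lie outside the interval visited earlier, so neither end of edge
  \<open>j\<close> falls strictly between the ends of edge \<open>i\<close>.\<close>

lemma wpath_noncrossing:
  assumes "walk h" "i < j" "j + 1 < nat n"
  shows "\<not> crosses {wvert h i mod n, wvert h (Suc i) mod n} {wvert h j mod n, wvert h (Suc j) mod n}"
proof -
  \<comment> \<open>Left end of the interval visited in \<open>j + 2\<close> steps. It contains all
    four end vertices, and \<open>j + 2 \<le> n\<close> makes it fit into a window of length
    \<open>n\<close>.\<close>
  let ?L = "h (j + 2) - int (j + 2) + 1"
  have n: "int (j + 2) \<le> n" using assms(3) by linarith
  have "wvert h k \<in> {?L..<?L + n}" if "k < j + 2" for k
    using wvert_bounds[OF assms(1) that] n by auto
  then have "crosses {wvert h i mod n, wvert h (Suc i) mod n} {wvert h j mod n, wvert h (Suc j) mod n}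
     \<longleftrightarrow> crosses {wvert h i, wvert h (Suc i)} {wvert h j, wvert h (Suc j)}"
    using assms(2) by (intro crosses_mod_iff[where L = ?L]) auto
  moreover have "\<not> between (wvert h i) (wvert h (Suc i)) x" if "x = wvert h j \<or> x = wvert h (Suc j)" for x
  proof (cases "Suc i = j")
    case True
    then show ?thesis
      using that wvert_bounds[OF assms(1,2)] wvert_new[OF assms(1), of j] wvert_new[OF assms(1), of "Suc j"]
        wvert_bounds[OF assms(1), of i "Suc j"] wvert_bounds[OF assms(1), of j "Suc j"]
      unfolding between_def by auto
  next
    case False
    then have ij: "i < j" "Suc i < j" using assms(2) by auto
    have "x \<le> h j - int j + 1 \<or> h j \<le> x"
      using that wvert_new[OF assms(1), of j] wvert_new[OF assms(1), of "Suc j"] by auto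
    then show ?thesis
      using wvert_bounds[OF assms(1) ij(1)] wvert_bounds[OF assms(1) ij(2)]
      unfolding between_def by auto
  qed
  ultimately show ?thesis unfolding crosses_iff_between by blast
qed

lemma not_crosses_self: "\<not> crosses {a, b} {a, b}"
  by (simp add: crosses_iff_between)

lemma card_verts: "card (verts m) = nat (npts m)"
  by (simp add: verts_def)

lemma walk_is_SHP:
  assumes "m \<ge> 2" "walk h"
  shows "is_SHP m (wpath m h)"
proof -
  let ?n = "npts m"
  have dist: "distinct (wpath m h)"
    unfolding distinct_conv_nth length_wpath
    using wvert_mod_inj[OF assms(2), of _ _ ?n] by (auto simp: wpath_nth nat_neq_iff) (metis zless_nat_eq_int_zless)+
  have "set (wpath m h) \<subseteq> verts m"
    using npts_ge_3[OF assms(1)] by (auto simp: wpath_def verts_def)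
  moreover have "card (set (wpath m h)) = card (verts m)"
    using distinct_card[OF dist] by (simp add: length_wpath card_verts)
  ultimately have "set (wpath m h) = verts m"
    by (intro card_subset_eq) (simp_all add: verts_def)
  moreover have "\<not> crosses (path_edge (wpath m h) i) (path_edge (wpath m h) j)"
    if "i + 1 < length (wpath m h)" "j + 1 < length (wpath m h)" for i j
  proof -
    have e: "path_edge (wpath m h) i = {wvert h i mod ?n, wvert h (Suc i) mod ?n}"
         "path_edge (wpath m h) j = {wvert h j mod ?n, wvert h (Suc j) mod ?n}"
      using that by (simp_all add: length_wpath wpath_edge edge_def)
    show ?thesis
      unfolding e using that wpath_noncrossing[OF assms(2), of i j ?n]
        wpath_noncrossing[OF assms(2), of j i ?n] not_crosses_self crosses_commute
      by (metis length_wpath linorder_neqE_nat)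
  qed
  ultimately show ?thesis using dist unfolding is_SHP_def by blast
qed

section \<open>From simple Hamiltonian paths back to walks\<close>

lemma predicate_switch:
  fixes P :: "nat \<Rightarrow> bool"
  assumes "i \<le> i'" "P i \<noteq> P i'"
  shows "\<exists>j. i \<le> j \<and> j < i' \<and> P j \<noteq> P (Suc j)"
  using assms
proof (induction i' rule: dec_induct)
  case (step i')
  then show ?case by (cases "P i = P i'") (auto intro: less_SucI)
qed simp

lemma is_SHP_length: "is_SHP m p \<Longrightarrow> length p = nat (npts m)"
  using distinct_card[of p] by (auto simp: is_SHP_def card_verts)

text \<open>The next vertex must be a neighbour of the visited interval: otherwise the edge to it
  separates the two free neighbours from each other, and the rest of the path has to cross that edge
  to reach both.\<close>

lemma SHP_prefix_is_walk:
  assumes "m \<ge> 2" "is_SHP m p" "v mod npts m = p ! 0" "k < nat (npts m)"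
  shows "\<exists>h. walk h \<and> h 0 = v - 1 \<and> h 1 = v \<and> (\<forall>i\<le>k. p ! i = wvert h i mod npts m)"
  using assms(4)
proof (induction k)
  case 0
  then show ?case
    \<comment> \<open>The first vertex counts as a right move from the empty interval
      \<open>[v, v - 1]\<close>; the moves not yet determined default to right.\<close>
    using assms(3) by (intro exI[of _ "\<lambda>i. v - 1 + int i"]) (auto simp: walk_def wvert_def)
next
  case (Suc k)
  define n where "n = npts m"
  have n: "n \<ge> 3" using npts_ge_3[OF assms(1)] by (simp add: n_def)
  have dist: "distinct p" and setp: "set p = verts m" and len: "length p = nat n"
    and nocross: "\<And>i j. i + 1 < length p \<Longrightarrow> j + 1 < length p \<Longrightarrow> \<not> crosses (path_edge p i) (path_edge p j)"
    using assms(2) is_SHP_length[OF assms(2)] by (auto simp: is_SHP_def n_def)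
  obtain h where h: "walk h" "h 0 = v - 1" "h 1 = v" "\<And>i. i \<le> k \<Longrightarrow> p ! i = wvert h i mod n"
    using Suc by (auto simp: n_def)
  define K where "K = Suc k"
  define hi lo where "hi = h K" and "lo = h K - int K + 1"
  have K: "K < nat n" using Suc.prems by (simp add: K_def n_def)
  have lohi: "lo \<le> hi" by (simp add: hi_def lo_def K_def)
  have pmod: "p ! i mod n = p ! i" if "i < nat n" for i
    using nth_mem[of i p] that len setp by (auto simp: verts_def n_def)
  have visited: "\<exists>i<K. p ! i = x mod n" if "lo \<le> x" "x \<le> hi" for x
  proof -
    have "x \<in> wvert h ` {..<K}"
      using that wvert_image[OF h(1), of K] by (simp add: hi_def lo_def)
    then show ?thesis using h(4) by (auto simp: K_def less_Suc_eq_le)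
  qed
  \<comment> \<open>Lifts \<open>p ! i\<close> to its first representative above \<open>hi\<close>.
    The unvisited vertices then fill the free arc from \<open>hi + 1\<close> to
    \<open>lo + n - 1\<close>, whose ends are the two neighbours of the visited interval.\<close>
  define z where "z i = hi + 1 + (p ! i - hi - 1) mod n" for i
  have zmod: "z i mod n = p ! i" if "i < nat n" for i
    using pmod[OF that] unfolding z_def by (simp add: mod_add_right_eq)
  have z_ge: "hi < z i" for i
    using pos_mod_sign[of n "p ! i - hi - 1"] n unfolding z_def by linarith
  have z_le: "z i < lo + n" if "K \<le> i" "i < nat n" for i
  proof (rule ccontr)
    assume "\<not> z i < lo + n"
    moreover have "z i \<le> hi + n"
      using pos_mod_bound[of n "p ! i - hi - 1"] n unfolding z_def by linarith
    ultimately obtain j where "j < K" "p ! j = (z i - n) mod n"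
      using visited[of "z i - n"] by auto
    then have "p ! j = p ! i" using zmod[OF that(2)] by simp
    then show False using dist that \<open>j < K\<close> len by (auto simp: distinct_conv_nth)
  qed
  have later: "\<exists>i. K \<le> i \<and> i < nat n \<and> z i = x" if "hi < x" "x < lo + n" for x
  proof -
    have "x mod n \<in> set p" using n setp by (simp add: verts_def n_def)
    then obtain i where i: "i < nat n" "p ! i = x mod n"
      using len by (auto simp: in_set_conv_nth)
    have "K \<le> i"
    proof (rule ccontr)
      assume "\<not> K \<le> i"
      then have iK: "i < K" by simp
      then have "wvert h i mod n = x mod n" using h(4)[of i] i by (auto simp: K_def)
      moreover have "lo \<le> wvert h i" "wvert h i \<le> hi"
        using wvert_bounds[OF h(1) iK] by (auto simp: lo_def hi_def)
      moreover have "\<bar>wvert h i - x\<bar> < n" using calculation that by linarith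
      ultimately have "wvert h i = x" using mod_eq_imp_eq by blast
      then show False using \<open>wvert h i \<le> hi\<close> that by simp
    qed
    moreover have "z i = x"
    proof (rule mod_eq_imp_eq)
      show "z i mod n = x mod n" using zmod[OF i(1)] i by simp
      show "\<bar>z i - x\<bar> < n"
        using z_ge[of i] z_le[OF \<open>K \<le> i\<close> i(1)] that lohi by linarith
    qed
    ultimately show ?thesis using i by blast
  qed
  have cur: "p ! k = wvert h k mod n" and curlh: "wvert h k = lo \<or> wvert h k = hi"
    using h(4)[of k] wvert_new[OF h(1), of k] by (auto simp: K_def hi_def lo_def)
  have ends: "z K = hi + 1 \<or> z K = lo + n - 1"
  proof (rule ccontr)
    assume "\<not> ?thesis"
    then have zK: "hi + 1 < z K" "z K < lo + n - 1"
      using z_ge[of K] z_le[of K] K by auto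
    obtain i1 where i1: "K \<le> i1" "i1 < nat n" "z i1 = hi + 1" using later[of "hi + 1"] zK by auto
    obtain i2 where i2: "K \<le> i2" "i2 < nat n" "z i2 = lo + n - 1" using later[of "lo + n - 1"] zK by auto
    have i12: "K < i1" "K < i2" using i1 i2 zK by (auto simp: le_less)
    \<comment> \<open>Both ends of the free arc come after step \<open>K\<close> and lie on
      different sides of \<open>z K\<close>, so some later edge jumps over
      \<open>z K\<close>.\<close>
    have "\<exists>j. K < j \<and> Suc j < nat n \<and> (z j < z K) \<noteq> (z (Suc j) < z K)"
    proof (cases "i1 \<le> i2")
      case True
      then obtain j where "i1 \<le> j" "j < i2" "(z j < z K) \<noteq> (z (Suc j) < z K)"
        using predicate_switch[of i1 i2 "\<lambda>j. z j < z K"] i1 i2 zK by auto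
      then show ?thesis using i12 i2 by (intro exI[of _ j]) auto
    next
      case False
      then obtain j where "i2 \<le> j" "j < i1" "(z j < z K) \<noteq> (z (Suc j) < z K)"
        using predicate_switch[of i2 i1 "\<lambda>j. z j < z K"] i1 i2 zK by auto
      then show ?thesis using i12 i1 by (intro exI[of _ j]) auto
    qed
    then obtain j where j: "K < j" "Suc j < nat n" "(z j < z K) \<noteq> (z (Suc j) < z K)" by blast
    have zne: "z i \<noteq> z K" if "K < i" "i < nat n" for i
    proof
      assume "z i = z K"
      then have "p ! i = p ! K" using zmod[of i] zmod[of K] that K by simp
      then show False using dist that len K by (auto simp: distinct_conv_nth)
    qed
    have zj: "z j \<noteq> z K" "z (Suc j) \<noteq> z K" "hi < z j" "hi < z (Suc j)" "z j < lo + n" "z (Suc j) < lo + n"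
      using zne[of j] zne[of "Suc j"] z_ge z_le[of j] z_le[of "Suc j"] j by auto
    \<comment> \<open>The current vertex is an end of the interval. A right end is lifted to
      \<open>hi\<close>, a left end to \<open>lo + n\<close>, so that it lies outside the free arc
      but in a common window of length \<open>n\<close> with it.\<close>
    define a where "a = (if wvert h k = hi then hi else lo + n)"
    have a: "a mod n = p ! k" using cur curlh by (auto simp: a_def)
    have "crosses {a mod n, z K mod n} {z j mod n, z (Suc j) mod n} \<longleftrightarrow>
        crosses {a, z K} {z j, z (Suc j)}"
    proof (intro crosses_mod_iff[where L = "if wvert h k = hi then hi else hi + 1"])
      show "{a, z K, z j, z (Suc j)} \<subseteq> {if wvert h k = hi then hi else hi + 1..<(if wvert h k = hi then hi else hi + 1) + n}"
        using zj zK lohi n by (auto simp: a_def)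
    qed
    moreover have "crosses {a, z K} {z j, z (Suc j)}"
      unfolding crosses_iff_between between_def
      using zj j(3) zK by (auto simp: a_def)
    ultimately have "crosses (path_edge p k) (path_edge p j)"
      using zmod[of K] zmod[of j] zmod[of "Suc j"] j K a by (simp add: path_edge_def K_def)
    then show False using nocross[of k j] j K len by (simp add: K_def)
  qed
  define c where "c = (if z K = hi + 1 then 1 else 0 :: int)"
  define h' where "h' i = (if i \<le> K then h i else hi + c)" for i
  have "walk h'"
    unfolding walk_def
  proof
    fix i
    show "h' (Suc i) = h' i \<or> h' (Suc i) = h' i + 1"
      using walkD[OF h(1), of i] by (cases "i = K") (auto simp: h'_def c_def hi_def)
  qed
  moreover have "p ! i = wvert h' i mod n" if "i \<le> K" for i
  proof (cases "i = K")
    case True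
    have "z K mod n = wvert h' K mod n"
    proof (cases "z K = hi + 1")
      case False
      then have "z K = lo + n - 1" using ends by simp
      then have "z K = wvert h' K + n"
        using False by (simp add: wvert_def h'_def c_def hi_def lo_def)
      then show ?thesis by simp
    qed (simp add: wvert_def h'_def c_def hi_def)
    then show ?thesis using True zmod K by simp
  next
    case False
    then show ?thesis using that h(4)[of i] by (simp add: wvert_def h'_def K_def)
  qed
  moreover have "h' 0 = v - 1" "h' 1 = v" using h(2,3) by (simp_all add: h'_def K_def)
  ultimately show ?case unfolding K_def n_def by blast
qed

text \<open>When one vertex is left, its two candidate lifts differ by \<open>n\<close>. The last
  move can therefore be normalised to a right move, which makes \<open>h n\<close> a lift of the
  last vertex.\<close>

lemma SHP_is_walk:
  assumes "m \<ge> 2" "is_SHP m p" "v mod npts m = p ! 0"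
  obtains h where "walk h" "h 0 = v - 1" "h 1 = v" "h (nat (npts m)) = h (nat (npts m) - 1) + 1"
    "p = wpath m h"
proof -
  define n where "n = npts m"
  define N where "N = nat n - 1"
  have n: "n \<ge> 3" "nat n = Suc N" using npts_ge_3[OF assms(1)] by (simp_all add: n_def N_def)
  obtain h where h: "walk h" "h 0 = v - 1" "h 1 = v" "\<And>i. i \<le> N \<Longrightarrow> p ! i = wvert h i mod n"
    using SHP_prefix_is_walk[OF assms, of N] n by (auto simp: n_def)
  define h' where "h' i = (if i \<le> N then h i else h N + 1)" for i
  have "walk h'"
    unfolding walk_def
  proof
    fix i
    show "h' (Suc i) = h' i \<or> h' (Suc i) = h' i + 1"
      using walkD[OF h(1), of i] by (cases "i = N") (auto simp: h'_def)
  qed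
  have same: "p ! i = wvert h' i mod n" if "i \<le> N" for i
  proof (cases "i = N")
    case True
    have "wvert h N mod n = wvert h' N mod n"
    proof (cases "h (Suc N) = h N")
      case eq: True
      have "int N = n - 1" using n by linarith
      then have "wvert h' N = wvert h N + n" using eq by (simp add: wvert_def h'_def)
      then show ?thesis by simp
    qed (simp add: wvert_def h'_def)
    then show ?thesis using h(4) True by simp
  next
    case False
    then show ?thesis using h(4)[of i] that by (simp add: wvert_def h'_def)
  qed
  have "p = wpath m h'"
  proof (rule nth_equalityI)
    show "length p = length (wpath m h')" using is_SHP_length[OF assms(2)] by (simp add: length_wpath)
    fix i assume "i < length p"
    then show "p ! i = wpath m h' ! i"
      using is_SHP_length[OF assms(2)] same[of i] n by (simp add: wpath_nth n_def)
  qed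
  moreover have "h' (nat (npts m)) = h' (nat (npts m) - 1) + 1" "h' 0 = v - 1" "h' 1 = v"
    using n h(2,3) by (auto simp: h'_def n_def)
  ultimately show ?thesis using that \<open>walk h'\<close> by blast
qed

section \<open>Directions of a hitting set\<close>

lemma hits_all_SHP_walk:
  assumes "m \<ge> 2" "hits_all_SHP m B" "walk h"
  obtains k where "int k + 1 < npts m" "edge m (wvert h k) (wvert h (Suc k)) \<in> B"
proof -
  obtain k where k: "k + 1 < length (wpath m h)" "path_edge (wpath m h) k \<in> B"
    using assms(2) walk_is_SHP[OF assms(1,3)] unfolding hits_all_SHP_def by blast
  then show ?thesis
    using that[of k] wpath_edge[of k m h] by (auto simp: length_wpath)
qed

lemma direction_edge:
  assumes "x mod npts m \<noteq> y mod npts m"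
  shows "direction m (edge m x y) = (x + y) mod npts m"
  using assms by (simp add: direction_def edge_def mod_add_eq)

lemma zigzag_directions:
  assumes "m \<ge> 2" "hits_all_SHP m B"
  shows "(2 * v) mod npts m \<in> direction m ` B \<or> (2 * v + 1) mod npts m \<in> direction m ` B"
proof -
  \<comment> \<open>This walk visits \<open>v\<close>, \<open>v + 1\<close>, \<open>v - 1\<close>,
    \<open>v + 2\<close>, and so on, so that the sums along its edges alternate between
    \<open>2 v + 1\<close> and \<open>2 v\<close>.\<close>
  define h where "h k = v + int k div 2" for k
  have "walk h" unfolding walk_def h_def by (intro allI) (simp; presburger)
  then obtain k where k: "int k + 1 < npts m" "edge m (wvert h k) (wvert h (Suc k)) \<in> B"
    using hits_all_SHP_walk[OF assms] by blast
  have "wvert h k + wvert h (Suc k) = 2 * v \<or> wvert h k + wvert h (Suc k) = 2 * v + 1"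
    unfolding wvert_def h_def by (cases "even k") (auto elim!: evenE oddE)
  moreover have "wvert h k mod npts m \<noteq> wvert h (Suc k) mod npts m"
    using wvert_mod_inj[OF \<open>walk h\<close>, of k "Suc k" "npts m"] k by simp
  ultimately show ?thesis
    using k(2) direction_edge by (metis image_eqI)
qed

lemma direction_cover:
  assumes "m \<ge> 2" "hits_all_SHP m B"
  shows "d mod npts m \<in> direction m ` B \<or> (d + 1) mod npts m \<in> direction m ` B"
proof -
  \<comment> \<open>Since \<open>2 m = n + 1\<close>, the inverse of 2 modulo \<open>n\<close> is
    \<open>m\<close>; hence every residue \<open>d\<close> is \<open>2 v\<close> for
    \<open>v = d m\<close>.\<close>
  have "2 * (d * m) = d + d * npts m" by (simp add: npts_def algebra_simps)
  then have "(2 * (d * m)) mod npts m = d mod npts m"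
    "(2 * (d * m) + 1) mod npts m = (d + 1) mod npts m"
    by (simp_all add: mod_mult_self1 add.commute[of "d * npts m"] flip: add.assoc)
       (metis add.commute add.left_commute mod_mult_self1)
  then show ?thesis using zigzag_directions[OF assms, of "d * m"] by simp
qed

text \<open>The shift \<open>x \<mapsto> x + 1\<close> maps the complement of \<open>D\<close> injectively into \<open>D\<close>; if \<open>card D = m\<close>, it
  misses a single element \<open>c\<close>, and this is the only element of \<open>D\<close> whose predecessor is also in \<open>D\<close>.\<close>
lemma odd_cycle_cover:
  fixes m n :: int and D :: "int set"
  assumes "m \<ge> 2" "n = 2 * m - 1" "D \<subseteq> {0..<n}"
    and cover: "\<And>d. d mod n \<in> D \<or> (d + 1) mod n \<in> D"
  shows "nat m \<le> card D"
    and "card D = nat m \<Longrightarrow> \<exists>c. D = {(c + 2 * t) mod n | t. 0 \<le> t \<and> t < m}"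
proof -
  define N where "N = {0..<n} - D"
  define f where "f x = (x + 1) mod n" for x
  have finD: "finite D" using assms(3) finite_subset by blast
  have n: "n \<ge> 3" using assms by simp
  have inj: "inj_on f {0..<n}"
  proof (rule inj_onI)
    fix x y assume xy: "x \<in> {0..<n}" "y \<in> {0..<n}" "f x = f y"
    then have "x + 1 = y + 1" unfolding f_def by (intro mod_eq_imp_eq[of "x + 1" n "y + 1"]) auto
    then show "x = y" by simp
  qed
  have fN: "f ` N \<subseteq> D"
  proof
    fix y assume "y \<in> f ` N"
    then obtain x where x: "x \<in> N" "y = f x" by blast
    then have "x mod n \<notin> D" by (simp add: N_def)
    then show "y \<in> D" using cover[of x] x by (simp add: f_def)
  qed
  have cardN: "card N = nat n - card D"
    unfolding N_def using assms(3) finD by (simp add: card_Diff_subset)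
  have cardfN: "card (f ` N) = card N"
    using inj by (intro card_image) (auto simp: N_def intro: inj_on_subset)
  have "card N \<le> card D" using card_mono[OF finD fN] cardfN by simp
  then show "nat m \<le> card D" using cardN assms(2) n by linarith
  assume cD: "card D = nat m"
  have "card (D - f ` N) = 1"
  proof -
    have "card (D - f ` N) = card D - card (f ` N)"
      using fN finD finite_subset by (intro card_Diff_subset) auto
    then show ?thesis using cardN cardfN cD assms(1,2) by linarith
  qed
  then obtain c where c: "D - f ` N = {c}" by (auto simp: card_1_singleton_iff)
  have isolated: "x = c" if "x \<in> D" "(x - 1) mod n \<in> D" for x
  proof (rule ccontr)
    assume "x \<noteq> c"
    then have "x \<in> f ` N" using that c by blast
    then obtain y where y: "y \<in> N" "x = f y" by blast
    then have "(x - 1) mod n = y" by (simp add: f_def N_def mod_simps)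
    then show False using y that by (simp add: N_def)
  qed
  \<comment> \<open>Proceeds from \<open>c\<close> in steps of 2: \<open>c + 2t + 1\<close> has its
    predecessor in \<open>D\<close> and is not \<open>c\<close>, so it is outside \<open>D\<close>,
    and the cover condition puts \<open>c + 2t + 2\<close> into \<open>D\<close>.\<close>
  have inD: "(c + 2 * int t) mod n \<in> D" if "int t < m" for t
    using that
  proof (induction t)
    case 0
    then show ?case using c assms(3) by (metis Diff_iff add.right_neutral atLeastLessThan_iff insertI1
          mod_pos_pos_trivial mult_zero_right of_nat_0 subsetD)
  next
    case (Suc t)
    let ?x = "(c + 2 * int t + 1) mod n"
    have "?x \<notin> D"
    proof
      assume x: "?x \<in> D"
      have "(?x - 1) mod n = (c + 2 * int t) mod n" by (simp add: mod_simps)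
      then have "?x = c" using isolated[OF x] Suc by simp
      moreover have "c mod n = c" using c assms(3) by (metis Diff_iff atLeastLessThan_iff insertI1 mod_pos_pos_trivial subsetD)
      ultimately have "(c + 2 * int t + 1) mod n = c mod n" by simp
      then have "c + 2 * int t + 1 = c"
        by (rule mod_eq_imp_eq) (use Suc.prems assms(2) in simp)
      then show False by simp
    qed
    then show ?case using cover[of "c + 2 * int t + 1"] by (simp add: algebra_simps)
  qed
  define g where "g t = (c + 2 * t) mod n" for t
  have "inj_on g {0..<m}"
  proof (rule inj_onI)
    fix x y assume xy: "x \<in> {0..<m}" "y \<in> {0..<m}" "g x = g y"
    then have "c + 2 * x = c + 2 * y"
      unfolding g_def using assms(2) by (intro mod_eq_imp_eq[of "c + 2 * x" n "c + 2 * y"]) auto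
    then show "x = y" by simp
  qed
  then have "card (g ` {0..<m}) = nat m" by (simp add: card_image)
  moreover have "g ` {0..<m} \<subseteq> D"
  proof
    fix y assume "y \<in> g ` {0..<m}"
    then obtain t where "0 \<le> t" "t < m" "y = g t" by auto
    then show "y \<in> D" using inD[of "nat t"] by (simp add: g_def)
  qed
  ultimately have "D = g ` {0..<m}" using card_subset_eq[OF finD] cD by metis
  also have "\<dots> = {(c + 2 * t) mod n | t. 0 \<le> t \<and> t < m}" by (auto simp: g_def)
  finally show "\<exists>c. D = {(c + 2 * t) mod n | t. 0 \<le> t \<and> t < m}" by blast
qed

section \<open>Minimum hitting sets and their normal form\<close>

lemma finite_edges: "finite (edges m)"
proof (rule finite_subset)
  show "edges m \<subseteq> Pow (verts m)" by (auto simp: edges_def)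
qed (simp add: verts_def)

lemma hitting_set_card:
  assumes "m \<ge> 2" "B \<subseteq> edges m" "hits_all_SHP m B"
  shows "nat m \<le> card B"
    and "card B = nat m \<Longrightarrow> card (direction m ` B) = nat m"
    and "card B = nat m \<Longrightarrow>
      \<exists>a. direction m ` B = {(2 * a + 2 * t + 1) mod npts m | t. 0 \<le> t \<and> t < m}"
proof -
  have fin: "finite B" using assms(2) finite_edges finite_subset by blast
  have D: "direction m ` B \<subseteq> {0..<npts m}"
    using npts_ge_3[OF assms(1)] by (auto simp: direction_def)
  have cD: "nat m \<le> card (direction m ` B)"
    by (rule odd_cycle_cover(1)[OF assms(1) npts_def D direction_cover[OF assms(1,3)]])
  then show "nat m \<le> card B" using card_image_le[OF fin, of "direction m"] by simp
  assume cB: "card B = nat m"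
  then show eq: "card (direction m ` B) = nat m" using cD card_image_le[OF fin, of "direction m"] by simp
  obtain c where c: "direction m ` B = {(c + 2 * t) mod npts m | t. 0 \<le> t \<and> t < m}"
    using odd_cycle_cover(2)[OF assms(1) npts_def D direction_cover[OF assms(1,3)] eq] by blast
  \<comment> \<open>Solves \<open>2 a + 1 = c\<close> modulo \<open>n\<close>, again with
    \<open>m\<close> as the inverse of 2.\<close>
  define a where "a = (c - 1) * m"
  have "2 * a + 2 * t + 1 = c + 2 * t + (c - 1) * npts m" for t
    by (simp add: a_def npts_def algebra_simps)
  then have "(2 * a + 2 * t + 1) mod npts m = (c + 2 * t) mod npts m" for t
    by (metis mod_mult_self1 mult.commute)
  then show "\<exists>a. direction m ` B = {(2 * a + 2 * t + 1) mod npts m | t. 0 \<le> t \<and> t < m}"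
    using c by (intro exI[of _ a]) simp
qed

text \<open>The edge of direction \<open>2t + 1\<close> that lies \<open>s\<close> steps above the boundary edge \<open>[t, t + 1]\<close>.\<close>
definition chord :: "int \<Rightarrow> int \<Rightarrow> int \<Rightarrow> int set" where
  "chord m t s = edge m (t - s) (t + 1 + s)"

text \<open>The normal form of a minimum hitting set: \<open>a\<close> is the rotation, and
  \<open>s\<close> records the heights of the chords over \<open>m\<close> consecutive boundary
  edges.\<close>

definition chord_set :: "int \<Rightarrow> int \<Rightarrow> (int \<Rightarrow> int) \<Rightarrow> int set set" where
  "chord_set m a s = {chord m (a + t) (s t) | t. 0 \<le> t \<and> t < m}"

lemma edge_as_chord:
  assumes "m \<ge> 2" "e \<in> edges m" "direction m e = (2 * t + 1) mod npts m"
  shows "\<exists>s. 0 \<le> s \<and> s \<le> m - 2 \<and> e = chord m t s"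
proof -
  define n where "n = npts m"
  have n: "n = 2 * m - 1" by (simp add: n_def npts_def)
  obtain x y where xy: "e = {x, y}" "x \<in> {0..<n}" "y \<in> {0..<n}" "x \<noteq> y"
    using assms(2) by (auto simp: edges_def verts_def n_def)
  have "(x + y) mod n = (2 * t + 1) mod n" using assms(3) xy by (simp add: direction_def n_def)
  then have ydvd: "n dvd x + y - (2 * t + 1)" by (simp add: mod_eq_dvd_iff)
  \<comment> \<open>Offset of \<open>x\<close> from \<open>t + 1\<close>. For
    \<open>u \<le> m - 2\<close> the vertex \<open>x\<close> is the right end of a chord of height
    \<open>u\<close>; for \<open>u \<ge> m\<close> it is the left end of one of height
    \<open>n - 1 - u\<close>; \<open>u = m - 1\<close> would give \<open>x = y\<close>.\<close>
  define u where "u = (x - t - 1) mod n"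
  have u: "0 \<le> u" "u < n" using assms(1) n by (auto simp: u_def)
  have xdvd: "n dvd x - (t + 1 + u)"
    unfolding u_def by (metis add.commute diff_diff_eq dvd_minus_mod)
  have e: "e = edge m p q" if "n dvd x - p" "n dvd y - q" for p q
  proof -
    have "x = p mod n" "y = q mod n"
      using that xy by (metis atLeastLessThan_iff mod_eq_dvd_iff mod_pos_pos_trivial)+
    then show ?thesis using xy by (simp add: edge_def n_def)
  qed
  have yd: "n dvd y - (t - u)"
    using dvd_diff[OF ydvd xdvd] by (simp add: algebra_simps)
  consider "u \<le> m - 2" | "u = m - 1" | "m \<le> u" by linarith
  then show ?thesis
  proof cases
    case 1
    then have "e = chord m t u"
      using e[OF xdvd yd] unfolding chord_def by (simp add: edge_def insert_commute)
    then show ?thesis using 1 u by blast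
  next
    case 2
    then have eq: "x - (t + 1 + u) - (y - (t - u)) + n = x - y" using n by simp
    have "n dvd x - y"
      using dvd_add[OF dvd_diff[OF xdvd yd] dvd_refl[of n]] by (simp only: eq)
    then have "x mod n = y mod n" by (simp add: mod_eq_dvd_iff)
    then have "x = y" using xy by simp
    then show ?thesis using xy by simp
  next
    case 3
    define s where "s = n - 1 - u"
    have "n dvd x - (t - s)" using dvd_add[OF xdvd dvd_refl] by (simp add: s_def algebra_simps)
    moreover have "n dvd y - (t + 1 + s)" using dvd_diff[OF yd dvd_refl] by (simp add: s_def algebra_simps)
    ultimately have "e = chord m t s" using e unfolding chord_def by blast
    then show ?thesis using 3 u n by (intro exI[of _ s]) (auto simp: s_def)
  qed
qed

text \<open>Equal cardinalities make \<open>direction m\<close> injective on \<open>B\<close>, so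
  each of the \<open>m\<close> directions selects exactly one chord.\<close>

lemma directions_imp_chord_set:
  assumes "m \<ge> 2" "B \<subseteq> edges m" "card B = nat m" "card (direction m ` B) = nat m"
    "direction m ` B = {(2 * a + 2 * t + 1) mod npts m | t. 0 \<le> t \<and> t < m}"
  obtains s where "\<And>t. 0 \<le> t \<Longrightarrow> t < m \<Longrightarrow> 0 \<le> s t \<and> s t \<le> m - 2" "B = chord_set m a s"
proof -
  have fin: "finite B" using assms(2) finite_edges finite_subset by blast
  have inj: "inj_on (direction m) B"
    using assms(3,4) fin by (simp add: eq_card_imp_inj_on)
  have "\<exists>s. 0 \<le> t \<and> t < m \<longrightarrow> 0 \<le> s \<and> s \<le> m - 2 \<and> chord m (a + t) s \<in> B \<and>
      direction m (chord m (a + t) s) = (2 * a + 2 * t + 1) mod npts m" for t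
  proof (cases "0 \<le> t \<and> t < m")
    case True
    then obtain e where e: "e \<in> B" "direction m e = (2 * a + 2 * t + 1) mod npts m"
      using assms(5) by (smt (verit) image_iff mem_Collect_eq)
    then show ?thesis
      using edge_as_chord[OF assms(1), of e "a + t"] assms(2) by (auto simp: algebra_simps)
  qed blast
  then obtain s where s: "\<And>t. 0 \<le> t \<and> t < m \<Longrightarrow> 0 \<le> s t \<and> s t \<le> m - 2 \<and> chord m (a + t) (s t) \<in> B \<and>
      direction m (chord m (a + t) (s t)) = (2 * a + 2 * t + 1) mod npts m"
    by metis
  have "B \<subseteq> chord_set m a s"
  proof
    fix e assume e: "e \<in> B"
    then obtain t where t: "0 \<le> t" "t < m" "direction m e = (2 * a + 2 * t + 1) mod npts m"
      using assms(5) by blast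
    then have "e = chord m (a + t) (s t)"
      using inj_onD[OF inj, of e "chord m (a + t) (s t)"] s[of t] e by simp
    then show "e \<in> chord_set m a s" using t by (auto simp: chord_set_def)
  qed
  moreover have "chord_set m a s \<subseteq> B" using s by (auto simp: chord_set_def)
  ultimately show ?thesis using that s by blast
qed

section \<open>Necessary conditions\<close>

lemma dvd_abs_less_2:
  fixes n z :: int
  assumes "n dvd z" "\<bar>z\<bar> < 2 * n"
  shows "z = 0 \<or> z = n \<or> z = - n"
proof -
  obtain q where q: "z = n * q" using assms(1) by blast
  have "n > 0" using assms(2) by linarith
  then have "\<bar>q\<bar> < 2" using assms(2) q by (simp add: abs_mult mult.commute[of n])
  then have "q = 0 \<or> q = 1 \<or> q = -1" by linarith
  then show ?thesis using q by auto
qed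

text \<open>Replaces equality of edges by arithmetic on lifted end vertices. The gap is known only
  up to complement in \<open>n\<close>, since a chord can be measured along either arc.\<close>

lemma edge_eq_chordD:
  assumes "edge m x y = chord m t s" "x \<noteq> y" "\<bar>x - y\<bar> < npts m" "0 \<le> s" "s \<le> m - 2"
  shows "npts m dvd x + y - (2 * t + 1)"
    and "\<bar>x - y\<bar> = 2 * s + 1 \<or> \<bar>x - y\<bar> = npts m - (2 * s + 1)"
proof -
  define n where "n = npts m"
  have n: "2 * s + 1 < n" using assms(5) by (simp add: n_def npts_def)
  have *: "n dvd x + y - (2 * t + 1) \<and> (\<bar>x - y\<bar> = 2 * s + 1 \<or> \<bar>x - y\<bar> = n - (2 * s + 1))"
    if d: "n dvd x - (t - s)" "n dvd y - (t + 1 + s)" and xy: "x \<noteq> y" "\<bar>x - y\<bar> < n" for x y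
  proof -
    have "n dvd x + y - (2 * t + 1)" using dvd_add[OF d] by (simp add: algebra_simps)
    moreover have "n dvd x - y + (2 * s + 1)" using dvd_diff[OF d] by (simp add: algebra_simps)
    then have "x - y + (2 * s + 1) = 0 \<or> x - y + (2 * s + 1) = n \<or> x - y + (2 * s + 1) = - n"
      using xy n assms(4) by (intro dvd_abs_less_2) auto
    ultimately show ?thesis using xy n assms(4) by linarith
  qed
  have "n dvd x - (t - s) \<and> n dvd y - (t + 1 + s) \<or> n dvd y - (t - s) \<and> n dvd x - (t + 1 + s)"
    using assms(1) unfolding edge_def chord_def doubleton_eq_iff n_def by (auto simp: mod_eq_dvd_iff)
  then have "n dvd x + y - (2 * t + 1) \<and> (\<bar>x - y\<bar> = 2 * s + 1 \<or> \<bar>x - y\<bar> = n - (2 * s + 1))"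
    using *[of x y] *[of y x] assms(2,3) by (auto simp: n_def abs_minus_commute add.commute[of x y])
  then show "npts m dvd x + y - (2 * t + 1)"
    "\<bar>x - y\<bar> = 2 * s + 1 \<or> \<bar>x - y\<bar> = npts m - (2 * s + 1)"
    by (auto simp: n_def)
qed

lemma chord_set_hits_walk:
  assumes "m \<ge> 2" "hits_all_SHP m (chord_set m a s)" "walk h"
    and s: "\<And>t. 0 \<le> t \<Longrightarrow> t < m \<Longrightarrow> 0 \<le> s t \<and> s t \<le> m - 2"
  obtains k t where "int k + 1 < 2 * m - 1" "0 \<le> t" "t < m"
    "(2 * m - 1) dvd wvert h k + wvert h (Suc k) - (2 * t + 1)"
    "\<bar>wvert h k - wvert h (Suc k)\<bar> = 2 * s t + 1 \<or>
     \<bar>wvert h k - wvert h (Suc k)\<bar> = 2 * m - 1 - (2 * s t + 1)"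
proof -
  \<comment> \<open>Shifting the walk by \<open>a\<close> moves the chord set to offset 0.\<close>
  define h' where "h' k = h k + a" for k
  have h': "walk h'" using assms(3) by (simp add: walk_def h'_def)
  have wv: "wvert h' k = wvert h k + a" for k by (simp add: wvert_def h'_def)
  obtain k where k: "int k + 1 < npts m" "edge m (wvert h' k) (wvert h' (Suc k)) \<in> chord_set m a s"
    using hits_all_SHP_walk[OF assms(1,2) h'] by blast
  then obtain t where t: "0 \<le> t" "t < m" "edge m (wvert h' k) (wvert h' (Suc k)) = chord m (a + t) (s t)"
    by (auto simp: chord_set_def)
  have "wvert h' k \<noteq> wvert h' (Suc k)"
    using wvert_mod_inj[OF h', of k "Suc k" "npts m"] k by auto
  moreover have "\<bar>wvert h' k - wvert h' (Suc k)\<bar> < npts m"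
    using wvert_new[OF h', of k] wvert_new[OF h', of "Suc k"] k by auto
  ultimately show ?thesis
    using that[of k t] edge_eq_chordD[OF t(3)] k t s[of t] unfolding wv
    by (auto simp: npts_def algebra_simps)
qed

section \<open>Testing the hitting condition on explicit walks\<close>

lemma wvert_cases:
  assumes "walk h"
  obtains
    (LL) "h (Suc k) = h k" "h (Suc (Suc k)) = h k" "wvert h k = h k - int k" "wvert h (Suc k) = h k - int k - 1"
  | (LR) "h (Suc k) = h k" "h (Suc (Suc k)) = h k + 1" "wvert h k = h k - int k" "wvert h (Suc k) = h k + 1"
  | (RL) "h (Suc k) = h k + 1" "h (Suc (Suc k)) = h k + 1" "wvert h k = h k + 1" "wvert h (Suc k) = h k - int k"
  | (RR) "h (Suc k) = h k + 1" "h (Suc (Suc k)) = h k + 2" "wvert h k = h k + 1" "wvert h (Suc k) = h k + 2"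
proof -
  have "h (Suc k) = h k \<and> h (Suc (Suc k)) = h k \<or> h (Suc k) = h k \<and> h (Suc (Suc k)) = h k + 1 \<or>
    h (Suc k) = h k + 1 \<and> h (Suc (Suc k)) = h k + 1 \<or> h (Suc k) = h k + 1 \<and> h (Suc (Suc k)) = h k + 2"
    using walkD[OF assms, of k] walkD[OF assms, of "Suc k"] by auto
  then show ?thesis
    by (elim disjE conjE) (rule LL LR RL RR; simp add: wvert_def; fail)+
qed

text \<open>Two equal moves use a boundary edge; a turn at step \<open>k\<close>, in either sense,
  joins the two neighbours of the visited interval, at distance \<open>k + 1\<close>.\<close>

lemma wvert_sum_diff:
  fixes h k
  defines "S \<equiv> wvert h k + wvert h (Suc k)" and "d \<equiv> \<bar>wvert h k - wvert h (Suc k)\<bar>"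
  assumes "walk h"
  shows "h (Suc (Suc k)) = h k \<and> S = 2 * h k - 2 * int k - 1 \<and> d = 1 \<or>
    h (Suc (Suc k)) = h k + 1 \<and> S = 2 * h k + 1 - int k \<and> d = int k + 1 \<or>
    h (Suc (Suc k)) = h k + 2 \<and> S = 2 * h k + 3 \<and> d = 1"
  using wvert_cases[OF assms(3), of k]
  by cases (auto simp: S_def d_def)

context
  fixes m a :: int and s :: "int \<Rightarrow> int"
  assumes m: "m \<ge> 2"
    and hits: "hits_all_SHP m (chord_set m a s)"
    and s: "\<And>t. 0 \<le> t \<Longrightarrow> t < m \<Longrightarrow> 0 \<le> s t \<and> s t \<le> m - 2"
begin

text \<open>Modulo the odd number \<open>n\<close> the sum \<open>S\<close> is
  \<open>2 u + 1\<close>, so its parity tells whether the lift agrees or is off by \<open>n\<close>.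
  As \<open>S\<close> and \<open>d\<close> have equal parity, it also tells which arc
  \<open>d\<close> measures.\<close>

lemma walk_meets_chord:
  assumes "walk h"
  shows "\<exists>k u S d. 0 \<le> u \<and> u < m \<and> 0 \<le> s u \<and> s u \<le> m - 2 \<and>
    S = wvert h k + wvert h (Suc k) \<and> d = \<bar>wvert h k - wvert h (Suc k)\<bar> \<and>
    (\<forall>x. S = 2 * x + 1 \<longrightarrow> 1 - m \<le> x \<longrightarrow> x \<le> 2 * m - 2 \<longrightarrow> u = x \<and> d = 2 * s u + 1) \<and>
    (\<forall>x. S = 2 * x \<longrightarrow> 1 - m \<le> x \<longrightarrow> x \<le> 2 * m - 2 \<longrightarrow>
       (u = x - m \<or> u = x + m - 1) \<and> d = 2 * m - 2 - 2 * s u)"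
proof -
  obtain k u where k: "int k + 1 < 2 * m - 1" "0 \<le> u" "u < m"
    "(2 * m - 1) dvd wvert h k + wvert h (Suc k) - (2 * u + 1)"
    "\<bar>wvert h k - wvert h (Suc k)\<bar> = 2 * s u + 1 \<or>
     \<bar>wvert h k - wvert h (Suc k)\<bar> = 2 * m - 1 - (2 * s u + 1)"
    using chord_set_hits_walk[OF m hits assms s] by blast
  define S d where "S = wvert h k + wvert h (Suc k)" and "d = \<bar>wvert h k - wvert h (Suc k)\<bar>"
  have par: "even S = even d" unfolding S_def d_def by simp
  have cases: "S - (2 * u + 1) = 0 \<or> S - (2 * u + 1) = 2 * m - 1 \<or> S - (2 * u + 1) = - (2 * m - 1)"
    if "2 * (1 - m) \<le> S" "S \<le> 4 * m - 3"
    using dvd_abs_less_2[of "2 * m - 1" "S - (2 * u + 1)"] k(2-4) that by (simp add: S_def)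
  have dc: "d = 2 * s u + 1 \<or> d = 2 * m - 1 - (2 * s u + 1)" using k(5) by (simp add: d_def)
  have 1: "u = x \<and> d = 2 * s u + 1" if "S = 2 * x + 1" "1 - m \<le> x" "x \<le> 2 * m - 2" for x
  proof -
    have "u = x" using cases that by presburger
    moreover have "odd d" using par that by simp
    then have "d = 2 * s u + 1" using dc by presburger
    ultimately show ?thesis by simp
  qed
  have 2: "(u = x - m \<or> u = x + m - 1) \<and> d = 2 * m - 2 - 2 * s u"
    if "S = 2 * x" "1 - m \<le> x" "x \<le> 2 * m - 2" for x
  proof -
    have "S - (2 * u + 1) \<noteq> 0" unfolding that(1) by presburger
    moreover have "2 * (1 - m) \<le> S" "S \<le> 4 * m - 3" using that by simp_all
    ultimately have "u = x - m \<or> u = x + m - 1" using cases that(1) by linarith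
    moreover have "even d" using par that by simp
    then have "d = 2 * m - 2 - 2 * s u" using dc by auto
    ultimately show ?thesis by simp
  qed
  show ?thesis
    by (intro exI[of _ k] exI[of _ u] exI[of _ S] exI[of _ d]) (use 1 2 k(2,3) s[of u] in \<open>simp add: S_def d_def\<close>)
qed

lemma another_boundary_edge:
  assumes "0 \<le> z" "z < m"
  shows "\<exists>t. 0 \<le> t \<and> t < m \<and> t \<noteq> z \<and> s t = 0"
proof -
  \<comment> \<open>The walk along the boundary from \<open>z + 1\<close> round to \<open>z\<close>;
    the only boundary edge it omits is \<open>[z, z + 1]\<close>.\<close>
  define h where "h k = z + int k" for k
  have "walk h" by (simp add: walk_def h_def)
  then obtain k t where k: "int k + 1 < 2 * m - 1" "0 \<le> t" "t < m"
    "(2 * m - 1) dvd wvert h k + wvert h (Suc k) - (2 * t + 1)"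
    "\<bar>wvert h k - wvert h (Suc k)\<bar> = 2 * s t + 1 \<or>
     \<bar>wvert h k - wvert h (Suc k)\<bar> = 2 * m - 1 - (2 * s t + 1)"
    using chord_set_hits_walk[OF m hits _ s] by blast
  have w: "wvert h k = z + 1 + int k" for k by (simp add: wvert_def h_def)
  have "s t = 0" using k(5) s[OF k(2,3)] unfolding w by presburger
  moreover have "t \<noteq> z"
  proof
    assume "t = z"
    then have "(2 * m - 1) dvd 2 * (int k + 1)" using k(4) unfolding w by (simp add: algebra_simps)
    then have "2 * (int k + 1) = 0 \<or> 2 * (int k + 1) = 2 * m - 1 \<or> 2 * (int k + 1) = - (2 * m - 1)"
      using k(1) by (intro dvd_abs_less_2) auto
    then show False by presburger
  qed
  ultimately show ?thesis using k by blast
qed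

text \<open>The path zigzags in the directions \<open>2t + 1\<close>, \<open>2t + 2\<close> and later, after \<open>2 j\<close> steps, in the directions
  \<open>2t + 2\<close>, \<open>2t + 3\<close>; the change costs one boundary edge of direction \<open>2 (t + j + 1) + 1\<close>. By the assumptions
  on \<open>s\<close> this boundary edge is the only one of its edges that can be in the set.\<close>
lemma descent_forces_zero:
  assumes "0 \<le> t" "t \<le> m - 2" "1 \<le> j" "s (t + 1) \<le> j" "j \<le> s t"
  shows "t + j + 1 < m \<and> s (t + j + 1) = 0"
proof -
  have jm: "j \<le> m - 2" using s[of t] assms by simp
  define h where "h k = (if int k \<le> 2 * j + 1 then t + (int k + 1) div 2 else t + 1 + int k div 2)" for k
  have "walk h" unfolding walk_def
  proof
    fix k
    define r where "r = int k div 2"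
    have "int k = 2 * r \<or> int k = 2 * r + 1" unfolding r_def by linarith
    then show "h (Suc k) = h k \<or> h (Suc k) = h k + 1"
      by (elim disjE) (auto simp: h_def; presburger)+
  qed
  from walk_meets_chord[OF this] obtain k u S d where k: "0 \<le> u" "u < m" "0 \<le> s u" "s u \<le> m - 2"
    and S: "S = wvert h k + wvert h (Suc k)" and d: "d = \<bar>wvert h k - wvert h (Suc k)\<bar>"
    and D1: "\<forall>x. S = 2 * x + 1 \<longrightarrow> 1 - m \<le> x \<longrightarrow> x \<le> 2 * m - 2 \<longrightarrow> u = x \<and> d = 2 * s u + 1"
    and D2: "\<forall>x. S = 2 * x \<longrightarrow> 1 - m \<le> x \<longrightarrow> x \<le> 2 * m - 2 \<longrightarrow>
       (u = x - m \<or> u = x + m - 1) \<and> d = 2 * m - 2 - 2 * s u"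
    by (elim exE conjE)
  note D1 = D1[rule_format] and D2 = D2[rule_format]
  note sd = wvert_sum_diff[OF \<open>walk h\<close>, of k, folded S d]
  define r where "r = int k div 2"
  have r: "0 \<le> r" by (simp add: r_def)
  \<comment> \<open>The edges of index \<open>t\<close> are too short for the chord over
    \<open>t\<close>, those of index \<open>t + 1\<close> too long for the chord over
    \<open>t + 1\<close>, and \<open>2 t + 2\<close> is none of the \<open>m\<close> directions. The
    boundary edge of index \<open>t + j + 1\<close> remains.\<close>
  have cl: "S = 2 * t + 1 \<and> d \<le> 2 * j - 1 \<or> S = 2 * t + 2 \<or> S = 2 * t + 3 \<and> 2 * j + 3 \<le> d \<or> S = 2 * t + 2 * j + 3 \<and> d = 1"
  proof (cases "int k = 2 * r")
    case True
    then have "h k = (if r \<le> j then t + r else t + 1 + r)"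
      "h (Suc (Suc k)) = (if r < j then t + 1 + r else t + 2 + r)"
      by (auto simp: h_def)
    then show ?thesis using sd r True by (simp split: if_splits)
  next
    case False
    then have odd: "int k = 2 * r + 1" unfolding r_def by linarith
    then have "h k = t + 1 + r" "h (Suc (Suc k)) = t + 2 + r"
      by (auto simp: h_def)
    then show ?thesis using sd r odd by (simp split: if_splits)
  qed
  have "u = t + j + 1 \<and> s u = 0"
    using cl D1[of t] D2[of "t + 1"] D1[of "t + 1"] D1[of "t + j + 1"] k assms jm by auto
  then show ?thesis using k by auto
qed

text \<open>Mirror image of the descent: the zigzag starts in the directions \<open>2 t + 2\<close>,
  \<open>2 t + 3\<close> and changes by two successive left moves to \<open>2 t + 1\<close>,
  \<open>2 t + 2\<close>. The boundary edge used for the change has index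
  \<open>t - j\<close>.\<close>

lemma ascent_forces_zero:
  assumes "0 \<le> t" "t \<le> m - 2" "1 \<le> j" "s t \<le> j" "j \<le> s (t + 1)"
  shows "0 \<le> t - j \<and> s (t - j) = 0"
proof -
  have jm: "j \<le> m - 2" using s[of "t + 1"] assms by simp
  define h where "h k = (t + 1 + (if int k \<le> 2 * j then int k div 2 else (int k - 1) div 2))" for k
  have "walk h" unfolding walk_def
  proof
    fix k
    define r where "r = int k div 2"
    have "int k = 2 * r \<or> int k = 2 * r + 1" unfolding r_def by linarith
    then show "h (Suc k) = h k \<or> h (Suc k) = h k + 1"
      by (elim disjE) (auto simp: h_def; presburger)+
  qed
  from walk_meets_chord[OF this] obtain k u S d where k: "0 \<le> u" "u < m" "0 \<le> s u" "s u \<le> m - 2"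
    and S: "S = wvert h k + wvert h (Suc k)" and d: "d = \<bar>wvert h k - wvert h (Suc k)\<bar>"
    and D1: "\<forall>x. S = 2 * x + 1 \<longrightarrow> 1 - m \<le> x \<longrightarrow> x \<le> 2 * m - 2 \<longrightarrow> u = x \<and> d = 2 * s u + 1"
    and D2: "\<forall>x. S = 2 * x \<longrightarrow> 1 - m \<le> x \<longrightarrow> x \<le> 2 * m - 2 \<longrightarrow>
       (u = x - m \<or> u = x + m - 1) \<and> d = 2 * m - 2 - 2 * s u"
    by (elim exE conjE)
  note D1 = D1[rule_format] and D2 = D2[rule_format]
  note sd = wvert_sum_diff[OF \<open>walk h\<close>, of k, folded S d]
  define r where "r = int k div 2"
  have r: "0 \<le> r" by (simp add: r_def)
  have cl: "S = 2 * t + 3 \<and> d \<le> 2 * j - 1 \<or> S = 2 * t + 2 \<or> S = 2 * t + 1 \<and> 2 * j + 3 \<le> d \<or> S = 2 * t - 2 * j + 1 \<and> d = 1"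
  proof (cases "int k = 2 * r")
    case True
    then have "h k = (if r \<le> j then t + 1 + r else t + r)"
      "h (Suc (Suc k)) = (if r < j then t + 2 + r else t + 1 + r)"
      by (auto simp: h_def)
    then show ?thesis using sd r True by (simp split: if_splits)
  next
    case False
    then have odd: "int k = 2 * r + 1" unfolding r_def by linarith
    then have "h k = t + 1 + r" "h (Suc (Suc k)) = t + 2 + r"
      by (auto simp: h_def)
    then show ?thesis using sd r odd by (simp split: if_splits)
  qed
  have "u = t - j \<and> s u = 0"
    using cl D1[of t] D2[of "t + 1"] D1[of "t + 1"] D1[of "t - j"] k assms jm by auto
  then show ?thesis using k by auto
qed

text \<open>Here the path changes from the directions 1, 2 to the directions \<open>-1\<close>, 0.\<close>
lemma outer_chords_bound:
  shows "s 0 + s (m - 1) \<le> m - 2"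
proof (rule ccontr)
  assume neg: "\<not> s 0 + s (m - 1) \<le> m - 2"
  define j where "j = s 0"
  have j: "1 \<le> j" "j \<le> m - 2" using neg s[of 0] s[of "m - 1"] m by (auto simp: j_def)
  define h where "h k = (if int k \<le> 2 * j then (int k + 1) div 2 else (int k - 1) div 2)" for k
  have "walk h" unfolding walk_def
  proof
    fix k
    define r where "r = int k div 2"
    have "int k = 2 * r \<or> int k = 2 * r + 1" unfolding r_def by linarith
    then show "h (Suc k) = h k \<or> h (Suc k) = h k + 1"
      by (elim disjE) (auto simp: h_def; presburger)+
  qed
  from walk_meets_chord[OF this] obtain k u S d where k: "0 \<le> u" "u < m" "0 \<le> s u" "s u \<le> m - 2"
    and S: "S = wvert h k + wvert h (Suc k)" and d: "d = \<bar>wvert h k - wvert h (Suc k)\<bar>"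
    and D1: "\<forall>x. S = 2 * x + 1 \<longrightarrow> 1 - m \<le> x \<longrightarrow> x \<le> 2 * m - 2 \<longrightarrow> u = x \<and> d = 2 * s u + 1"
    and D2: "\<forall>x. S = 2 * x \<longrightarrow> 1 - m \<le> x \<longrightarrow> x \<le> 2 * m - 2 \<longrightarrow>
       (u = x - m \<or> u = x + m - 1) \<and> d = 2 * m - 2 - 2 * s u"
    by (elim exE conjE)
  note D1 = D1[rule_format] and D2 = D2[rule_format]
  note sd = wvert_sum_diff[OF \<open>walk h\<close>, of k, folded S d]
  define r where "r = int k div 2"
  have r: "0 \<le> r" by (simp add: r_def)
  \<comment> \<open>Direction 0 belongs to the chord over \<open>m - 1\<close>, since
    \<open>2 (m - 1) + 1 = n\<close>. With sum 0 this chord has gap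
    \<open>2 m - 2 - 2 s (m - 1)\<close>, by the assumed failure at most \<open>2 j\<close> and so
    below the gaps used; the chord over 0 has gap \<open>2 j + 1\<close>, above those used. The
    other sums are not directions of the set.\<close>
  have cl: "S = 1 \<and> d \<le> 2 * j - 1 \<or> S = - 2 * j - 1 \<or> S = - 1 \<or> S = 2 \<or> S = - 2 * j + 1 \<or> S = 0 \<and> 2 * j + 2 \<le> d"
  proof (cases "int k = 2 * r")
    case True
    then have "h k = (if r \<le> j then r else r - 1)" "h (Suc (Suc k)) = (if r < j then r + 1 else r)"
      by (auto simp: h_def)
    then show ?thesis using sd r True by (simp split: if_splits)
  next
    case False
    then have odd: "int k = 2 * r + 1" unfolding r_def by linarith
    then have "h k = (if r < j then r + 1 else r)" "h (Suc (Suc k)) = (if r + 1 < j then r + 2 else r + 1)"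
      by (auto simp: h_def)
    then show ?thesis using sd r odd by (simp split: if_splits)
  qed
  show False
    using cl D1[of 0] D1[of "- j - 1"] D1[of "- 1"] D2[of 1] D1[of "- j"] D2[of 0] k j m neg
    by (auto simp: j_def)
qed

text \<open>Here the path passes from the directions \<open>-1\<close>, 0 via 0, 1 to 1, 2, using the two boundary edges with
  indices \<open>j\<close> and \<open>l\<close>.\<close>
lemma interior_nonzero_unique:
  assumes "1 \<le> j" "j < l" "l \<le> m - 2" "s 0 \<le> j" "s (m - 1) \<le> m - 1 - l"
  shows "s j = 0 \<or> s l = 0"
proof (rule ccontr)
  assume neg: "\<not> (s j = 0 \<or> s l = 0)"
  define h where "h k = (if int k \<le> 2 * j + 1 then (int k - 1) div 2 else if int k \<le> 2 * l then int k div 2 else (int k + 1) div 2)" for k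
  have "walk h" unfolding walk_def
  proof
    fix k
    define r where "r = int k div 2"
    have "int k = 2 * r \<or> int k = 2 * r + 1" unfolding r_def by linarith
    then show "h (Suc k) = h k \<or> h (Suc k) = h k + 1"
      by (elim disjE) (auto simp: h_def; presburger)+
  qed
  from walk_meets_chord[OF this] obtain k u S d where k: "0 \<le> u" "u < m" "0 \<le> s u" "s u \<le> m - 2"
    and S: "S = wvert h k + wvert h (Suc k)" and d: "d = \<bar>wvert h k - wvert h (Suc k)\<bar>"
    and D1: "\<forall>x. S = 2 * x + 1 \<longrightarrow> 1 - m \<le> x \<longrightarrow> x \<le> 2 * m - 2 \<longrightarrow> u = x \<and> d = 2 * s u + 1"
    and D2: "\<forall>x. S = 2 * x \<longrightarrow> 1 - m \<le> x \<longrightarrow> x \<le> 2 * m - 2 \<longrightarrow>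
       (u = x - m \<or> u = x + m - 1) \<and> d = 2 * m - 2 - 2 * s u"
    by (elim exE conjE)
  note D1 = D1[rule_format] and D2 = D2[rule_format]
  note sd = wvert_sum_diff[OF \<open>walk h\<close>, of k, folded S d]
  define r where "r = int k div 2"
  have r: "0 \<le> r" by (simp add: r_def)
  \<comment> \<open>Sum 1 occurs only with gaps above \<open>2 s 0 + 1\<close>, sum 0 only with gaps
    below that of the chord over \<open>m - 1\<close>; the sums \<open>-1\<close> and 2 are not
    directions of the set. Only the two boundary edges could hit it.\<close>
  have cl: "S = - 1 \<or> S = 2 * j + 1 \<and> d = 1 \<or> S = 1 \<and> 2 * j + 3 \<le> d \<or> S = 0 \<and> d \<le> 2 * l - 2 \<or> S = 2 * l + 1 \<and> d = 1 \<or> S = 2"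
  proof (cases "int k = 2 * r")
    case True
    then have "h k = (if r \<le> j then r - 1 else r)" "h (Suc (Suc k)) = (if r < j then r else r + 1)"
      by (auto simp: h_def)
    then show ?thesis using sd r True by (simp split: if_splits)
  next
    case False
    then have odd: "int k = 2 * r + 1" unfolding r_def by linarith
    then have "h k = (if r < l then r else r + 1)" "h (Suc (Suc k)) = (if r + 1 < l then r + 1 else r + 2)"
      using assms(2) by (auto simp: h_def)
    then show ?thesis using sd r odd by (simp split: if_splits)
  qed
  show False
    using cl D1[of "- 1"] D1[of j] D1[of 0] D2[of 0] D1[of l] D2[of 1] k assms m neg by auto
qed

end

section \<open>From the conditions to the two classes\<close>

text \<open>Failure of strict decrease before the first zero \<alpha> would, with
  \<open>j = s t\<close>, produce a still earlier zero. On a descent every positive \<open>j\<close>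
  from \<open>s (t + 1)\<close> to \<open>s t\<close> gives the zero \<open>t + j + 1\<close>, and
  these runs of zeros join up to \<open>1 + s 0\<close>.\<close>

lemma left_slope:
  fixes s :: "int \<Rightarrow> int"
  assumes descent: "\<And>t j. 0 \<le> t \<Longrightarrow> t \<le> m - 2 \<Longrightarrow> 1 \<le> j \<Longrightarrow> s (t + 1) \<le> j \<Longrightarrow> j \<le> s t \<Longrightarrow>
      t + j + 1 < m \<and> s (t + j + 1) = 0"
    and ascent: "\<And>t j. 0 \<le> t \<Longrightarrow> t \<le> m - 2 \<Longrightarrow> 1 \<le> j \<Longrightarrow> s t \<le> j \<Longrightarrow> j \<le> s (t + 1) \<Longrightarrow>
      0 \<le> t - j \<and> s (t - j) = 0"
    and "\<alpha> < m" "s \<alpha> = 0" and pos: "\<And>t. 0 \<le> t \<Longrightarrow> t < \<alpha> \<Longrightarrow> 0 < s t"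
  shows "\<And>t. 0 \<le> t \<Longrightarrow> t < \<alpha> \<Longrightarrow> s (t + 1) < s t"
    and "\<And>i. 0 < \<alpha> \<Longrightarrow> \<alpha> \<le> i \<Longrightarrow> i \<le> 1 + s 0 \<Longrightarrow> i < m \<and> s i = 0"
proof -
  show dec: "s (t + 1) < s t" if t: "0 \<le> t" "t < \<alpha>" for t
  proof (cases "t + 1 = \<alpha>")
    case True
    then show ?thesis using pos[OF t] assms(4) by simp
  next
    case False
    show ?thesis
    proof (rule ccontr)
      assume "\<not> ?thesis"
      then have "0 \<le> t - s t \<and> s (t - s t) = 0"
        using ascent[of t "s t"] pos[OF t] t assms(3) False by auto
      then show False using pos[of "t - s t"] pos[OF t] t by auto
    qed
  qed
  \<comment> \<open>Here \<open>d\<close> counts leftwards from \<open>\<alpha> - 1\<close>. With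
    \<open>t = \<alpha> - 1 - d\<close> the bound on \<open>i\<close> is \<open>t + 1 + s t\<close>,
    the right end of the chord over \<open>t\<close>.\<close>
  have zeros: "i < m \<and> s i = 0"
    if "int d < \<alpha>" "\<alpha> \<le> i" "i \<le> \<alpha> - int d + s (\<alpha> - 1 - int d)" for d i
    using that
  proof (induction d arbitrary: i)
    case 0
    show ?case
    proof (cases "i = \<alpha>")
      case False
      then show ?thesis using descent[of "\<alpha> - 1" "i - \<alpha>"] 0 assms(3,4) by auto
    qed (use assms(3,4) in simp)
  next
    case (Suc d)
    define t where "t = \<alpha> - 1 - int (Suc d)"
    have t1: "\<alpha> - 1 - int d = t + 1" by (simp add: t_def)
    show ?case
    proof (cases "i \<le> \<alpha> - int d + s (\<alpha> - 1 - int d)")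
      case True
      then show ?thesis using Suc by simp
    next
      case False
      moreover have "0 < s (t + 1)" using pos[of "t + 1"] Suc.prems by (simp add: t_def)
      ultimately have "t + (i - t - 1) + 1 < m \<and> s (t + (i - t - 1) + 1) = 0"
        using Suc.prems assms(3) t1 by - (rule descent, auto simp: t_def)
      then show ?thesis by simp
    qed
  qed
  show "i < m \<and> s i = 0" if "0 < \<alpha>" "\<alpha> \<le> i" "i \<le> 1 + s 0" for i
    using zeros[of "nat (\<alpha> - 1)" i] that by simp
qed

lemma strict_decrease_bounds:
  fixes s :: "int \<Rightarrow> int"
  assumes "\<And>t. 0 \<le> t \<Longrightarrow> t + 1 < \<alpha> \<Longrightarrow> s (t + 1) < s t"
    and "\<And>t. 0 \<le> t \<Longrightarrow> t < \<alpha> \<Longrightarrow> 0 < s t"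
    and t: "0 \<le> t" "t < \<alpha>"
  shows "\<alpha> - t \<le> s t" "t + s t \<le> s 0"
proof -
  have "int d < \<alpha> \<Longrightarrow> int d + s (int d) \<le> s 0" for d
  proof (induction d)
    case (Suc d)
    then show ?case using assms(1)[of "int d"] by (simp add: add.commute)
  qed simp
  from this[of "nat t"] show "t + s t \<le> s 0" using t by simp
  have "int d < \<alpha> \<Longrightarrow> int d + 1 \<le> s (\<alpha> - 1 - int d)" for d
  proof (induction d)
    case 0
    then show ?case using assms(2)[of "\<alpha> - 1"] by simp
  next
    case (Suc d)
    define t where "t = \<alpha> - 1 - int (Suc d)"
    have t1: "\<alpha> - 1 - int d = t + 1" by (simp add: t_def)
    have "int d + 1 \<le> s (t + 1)" using Suc unfolding t1 by simp
    moreover have "s (t + 1) < s t" using Suc.prems by (intro assms(1)) (simp_all add: t_def)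
    ultimately show ?case unfolding t_def[symmetric] by simp
  qed
  from this[of "nat (\<alpha> - 1 - t)"] show "\<alpha> - t \<le> s t" using t by simp
qed

text \<open>Translates between the index \<open>t\<close> and the numbering of the classes:
  \<open>i = t + 1\<close> on the left slope and \<open>j = m - t\<close> on the right
  slope.\<close>

lemma chord_set_split:
  assumes "0 \<le> \<alpha>" "\<alpha> \<le> m - \<delta>" "0 \<le> \<delta>"
  shows "chord_set m 0 s = {chord m t (s t) | t. \<alpha> \<le> t \<and> t < m - \<delta>}
    \<union> {edge m (i - 1 - s (i - 1)) (i + s (i - 1)) | i. 1 \<le> i \<and> i \<le> \<alpha>}
    \<union> {edge m (m - j - s (m - j)) (m - j + 1 + s (m - j)) | j. 1 \<le> j \<and> j \<le> \<delta>}"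
    (is "_ = ?M \<union> ?L \<union> ?R")
proof -
  have "chord m t (s t) \<in> ?M \<union> ?L \<union> ?R" if "0 \<le> t" "t < m" for t
  proof -
    consider "t < \<alpha>" | "\<alpha> \<le> t" "t < m - \<delta>" | "m - \<delta> \<le> t" by linarith
    then show ?thesis
    proof cases
      case 1
      then have "chord m t (s t) \<in> ?L"
        using that by (intro CollectI exI[of _ "t + 1"]) (simp add: chord_def)
      then show ?thesis by blast
    next
      case 3
      then have "chord m t (s t) \<in> ?R"
        using that by (intro CollectI exI[of _ "m - t"]) (simp add: chord_def)
      then show ?thesis by blast
    qed blast
  qed
  then have sub: "chord_set m 0 s \<subseteq> ?M \<union> ?L \<union> ?R" unfolding chord_set_def add_0 by blast
  have inM: "e \<in> chord_set m 0 s" if e: "e \<in> ?M" for e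
  proof -
    obtain t where "\<alpha> \<le> t" "t < m - \<delta>" "e = chord m t (s t)" using e by blast
    then show ?thesis using assms unfolding chord_set_def by (intro CollectI exI[of _ t]) simp
  qed
  have inL: "e \<in> chord_set m 0 s" if e: "e \<in> ?L" for e
  proof -
    obtain i where "1 \<le> i" "i \<le> \<alpha>" "e = edge m (i - 1 - s (i - 1)) (i + s (i - 1))" using e by blast
    then show ?thesis using assms unfolding chord_set_def
      by (intro CollectI exI[of _ "i - 1"]) (simp add: chord_def)
  qed
  have inR: "e \<in> chord_set m 0 s" if e: "e \<in> ?R" for e
  proof -
    obtain j where "1 \<le> j" "j \<le> \<delta>" "e = edge m (m - j - s (m - j)) (m - j + 1 + s (m - j))" using e by blast
    then show ?thesis using assms unfolding chord_set_def
      by (intro CollectI exI[of _ "m - j"]) (simp add: chord_def)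
  qed
  show ?thesis by (rule equalityI[OF sub], intro Un_least subsetI) (erule inM inL inR)+
qed

lemma chords_zero:
  assumes "\<And>t. a \<le> t \<Longrightarrow> t < b \<Longrightarrow> s t = 0"
  shows "{chord m t (s t) | t. a \<le> t \<and> t < b} = bpath m a b"
  unfolding bpath_def setcompr_eq_image by (intro image_cong) (simp_all add: chord_def assms)

lemma chords_one_nonzero:
  assumes "\<And>t. a \<le> t \<Longrightarrow> t < b \<Longrightarrow> t \<noteq> g \<Longrightarrow> s t = 0" "a \<le> g" "g < b"
  shows "{chord m t (s t) | t. a \<le> t \<and> t < b} =
    bpath m a g \<union> bpath m (g + 1) b \<union> {edge m (g - s g) (g + 1 + s g)}"
proof -
  have "{chord m t (s t) | t. a \<le> t \<and> t < b} =
    {chord m t (s t) | t. a \<le> t \<and> t < g} \<union> {chord m t (s t) | t. g + 1 \<le> t \<and> t < b} \<union> {chord m g (s g)}"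
    (is "?X = ?Y")
  proof (intro equalityI subsetI)
    fix e assume "e \<in> ?X"
    then obtain t where t: "a \<le> t" "t < b" "e = chord m t (s t)" by blast
    consider "t < g" | "t = g" | "g + 1 \<le> t" by linarith
    then show "e \<in> ?Y" using t by cases blast+
  next
    fix e assume "e \<in> ?Y"
    then consider t where "a \<le> t" "t < g" "e = chord m t (s t)"
      | t where "g + 1 \<le> t" "t < b" "e = chord m t (s t)" | "e = chord m g (s g)" by blast
    then show "e \<in> ?X"
    proof cases
      case (1 t)
      then show ?thesis using assms(3) by (intro CollectI exI[of _ t]) simp
    next
      case (2 t)
      then show ?thesis using assms(2) by (intro CollectI exI[of _ t]) simp
    qed (use assms(2,3) in blast)
  qed
  then show ?thesis using assms chords_zero[of a g s m] chords_zero[of "g + 1" b s m] by (simp add: chord_def)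
qed

lemma chord_set_in_classes:
  fixes s :: "int \<Rightarrow> int"
  assumes m: "m \<ge> 2"
    and s: "\<And>t. 0 \<le> t \<Longrightarrow> t < m \<Longrightarrow> 0 \<le> s t \<and> s t \<le> m - 2"
    and zero: "\<And>z. 0 \<le> z \<Longrightarrow> z < m \<Longrightarrow> \<exists>t. 0 \<le> t \<and> t < m \<and> t \<noteq> z \<and> s t = 0"
    and descent: "\<And>t j. 0 \<le> t \<Longrightarrow> t \<le> m - 2 \<Longrightarrow> 1 \<le> j \<Longrightarrow> s (t + 1) \<le> j \<Longrightarrow> j \<le> s t \<Longrightarrow>
      t + j + 1 < m \<and> s (t + j + 1) = 0"
    and ascent: "\<And>t j. 0 \<le> t \<Longrightarrow> t \<le> m - 2 \<Longrightarrow> 1 \<le> j \<Longrightarrow> s t \<le> j \<Longrightarrow> j \<le> s (t + 1) \<Longrightarrow>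
      0 \<le> t - j \<and> s (t - j) = 0"
    and ends: "s 0 + s (m - 1) \<le> m - 2"
    and interior: "\<And>j l. 1 \<le> j \<Longrightarrow> j < l \<Longrightarrow> l \<le> m - 2 \<Longrightarrow> s 0 \<le> j \<Longrightarrow> s (m - 1) \<le> m - 1 - l \<Longrightarrow>
      s j = 0 \<or> s l = 0"
  shows "chord_set m 0 s \<in> classA m \<union> classB m"
proof -
  define Z where "Z = {t \<in> {0..<m}. s t = 0}"
  have "finite Z" by (rule finite_subset[of _ "{0..<m}"]) (auto simp: Z_def)
  moreover have "Z \<noteq> {}" using zero[of 0] m by (auto simp: Z_def)
  ultimately have Z: "finite Z" "Z \<noteq> {}" .
  define \<alpha> \<mu> where "\<alpha> = Min Z" and "\<mu> = Max Z"
  have a: "0 \<le> \<alpha>" "\<alpha> < m" "s \<alpha> = 0" using Min_in[OF Z] by (auto simp: \<alpha>_def Z_def)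
  have u: "0 \<le> \<mu>" "\<mu> < m" "s \<mu> = 0" using Max_in[OF Z] by (auto simp: \<mu>_def Z_def)
  have a_least: "\<alpha> \<le> t" and u_greatest: "t \<le> \<mu>" if "0 \<le> t" "t < m" "s t = 0" for t
    using that Z by (auto simp: \<alpha>_def \<mu>_def Z_def)
  \<comment> \<open>A second zero separates the first zero \<alpha> from the last zero \<mu>; this
    is the condition \<open>\<alpha> + \<delta> \<le> m - 2\<close>.\<close>
  obtain t0 where "0 \<le> t0" "t0 < m" "t0 \<noteq> \<alpha>" "s t0 = 0" using zero[of \<alpha>] a by blast
  then have au: "\<alpha> < \<mu>" using a_least[of t0] u_greatest[of t0] by simp
  define \<delta> where "\<delta> = m - 1 - \<mu>"
  have d: "0 \<le> \<delta>" "m - \<delta> = \<mu> + 1" using u by (simp_all add: \<delta>_def)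
  have pos: "0 < s t" if "0 \<le> t" "t < \<alpha>" for t
    using s[of t] a_least[of t] that a by force
  have left: "\<And>t. 0 \<le> t \<Longrightarrow> t < \<alpha> \<Longrightarrow> s (t + 1) < s t"
    "\<And>i. 0 < \<alpha> \<Longrightarrow> \<alpha> \<le> i \<Longrightarrow> i \<le> 1 + s 0 \<Longrightarrow> i < m \<and> s i = 0"
    using left_slope[OF descent ascent a(2,3) pos] by blast+
  \<comment> \<open>Reading \<open>s\<close> from the right exchanges the descent and ascent
    conditions, so \<open>left_slope\<close> also describes the right slope.\<close>
  define s' where "s' t = s (m - 1 - t)" for t
  have pos': "0 < s' t" if "0 \<le> t" "t < \<delta>" for t
    using s[of "m - 1 - t"] u_greatest[of "m - 1 - t"] that u unfolding \<delta>_def s'_def by force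
  have descent': "t + j + 1 < m \<and> s' (t + j + 1) = 0"
    if "0 \<le> t" "t \<le> m - 2" "1 \<le> j" "s' (t + 1) \<le> j" "j \<le> s' t" for t j
    using ascent[of "m - 2 - t" j] that by (simp add: s'_def algebra_simps)
  have ascent': "0 \<le> t - j \<and> s' (t - j) = 0"
    if "0 \<le> t" "t \<le> m - 2" "1 \<le> j" "s' t \<le> j" "j \<le> s' (t + 1)" for t j
    using descent[of "m - 2 - t" j] that by (simp add: s'_def algebra_simps)
  have dm: "\<delta> < m" "s' \<delta> = 0" using u by (auto simp: \<delta>_def s'_def)
  have right: "\<And>t. 0 \<le> t \<Longrightarrow> t < \<delta> \<Longrightarrow> s' (t + 1) < s' t"
    "\<And>i. 0 < \<delta> \<Longrightarrow> \<delta> \<le> i \<Longrightarrow> i \<le> 1 + s' 0 \<Longrightarrow> i < m \<and> s' i = 0"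
    using left_slope[OF descent' ascent' dm pos'] by blast+
  have left_bounds: "\<alpha> - t \<le> s t" "t + s t \<le> s 0" if "0 \<le> t" "t < \<alpha>" for t
    using strict_decrease_bounds[of \<alpha> s t] left(1) pos that by auto
  have right_bounds: "\<delta> - t \<le> s' t" "t + s' t \<le> s' 0" if "0 \<le> t" "t < \<delta>" for t
    using strict_decrease_bounds[of \<delta> s' t] right(1) pos' that by auto
  have s0: "s 0 < \<mu>" if "0 < \<alpha>"
    using left(2)[of "1 + s 0"] left_bounds(1)[of 0] that u_greatest[of "1 + s 0"] by auto
  have s'0: "s' 0 < m - 1 - \<alpha>" if "0 < \<delta>"
    using right(2)[of "1 + s' 0"] right_bounds(1)[of 0] that a_least[of "m - 1 - (1 + s' 0)"]
    by (auto simp: s'_def)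
  \<comment> \<open>If \<open>0 < \<alpha>\<close>, the zeros starting at \<alpha> reach
    \<open>1 + s 0\<close>, so an interior nonzero index lies beyond that point;
    \<open>right_gap\<close> is the mirror image.\<close>
  have left_gap: "s 0 < g \<and> (0 < \<alpha> \<longrightarrow> 1 + s 0 < g)" if "\<alpha> < g" "s g \<noteq> 0" for g
    using left(2)[of g] that a by (cases "\<alpha> = 0") force+
  have right_gap: "g < m - 1 - s (m - 1) \<and> (0 < \<delta> \<longrightarrow> g < m - 2 - s (m - 1))"
    if "g < \<mu>" "s g \<noteq> 0" for g
  proof (cases "\<delta> = 0")
    case True
    then show ?thesis using that dm by (simp add: s'_def \<delta>_def)
  next
    case False
    then have "\<not> m - 1 - g \<le> 1 + s' 0"
      using right(2)[of "m - 1 - g"] that d by (auto simp: s'_def \<delta>_def)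
    then show ?thesis by (simp add: s'_def)
  qed
  have split: "chord_set m 0 s = {chord m t (s t) | t. \<alpha> \<le> t \<and> t < m - \<delta>}
    \<union> {edge m (i - 1 - s (i - 1)) (i + s (i - 1)) | i. 1 \<le> i \<and> i \<le> \<alpha>}
    \<union> {edge m (m - j - s (m - j)) (m - j + 1 + s (m - j)) | j. 1 \<le> j \<and> j \<le> \<delta>}"
    using a d au by (intro chord_set_split) auto
  have dec: "\<forall>i. 1 \<le> i \<and> i < \<alpha> \<longrightarrow> s (i - 1) > s (i + 1 - 1)"
    using left(1)[of "i - 1" for i] by auto
  have inc: "\<forall>j. 1 \<le> j \<and> j < \<delta> \<longrightarrow> s (m - j) > s (m - (j + 1))"
  proof (intro allI impI)
    fix j assume "1 \<le> j \<and> j < \<delta>"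
    then show "s (m - j) > s (m - (j + 1))"
      using right(1)[of "j - 1"] by (simp add: s'_def algebra_simps)
  qed
  show ?thesis
  proof (cases "\<exists>g. \<alpha> < g \<and> g < \<mu> \<and> s g \<noteq> 0")
    case False
    then have zeros: "s t = 0" if "\<alpha> \<le> t" "t < m - \<delta>" for t
      using that a u d by (cases "t = \<alpha> \<or> t = \<mu>") auto
    have "\<forall>i. 1 \<le> i \<and> i \<le> \<alpha> \<longrightarrow> 0 < s (i - 1) \<and> \<alpha> - i + 1 \<le> s (i - 1) \<and> s (i - 1) \<le> m - \<delta> - i - 1"
    proof (intro allI impI)
      fix i assume i: "1 \<le> i \<and> i \<le> \<alpha>"
      then show "0 < s (i - 1) \<and> \<alpha> - i + 1 \<le> s (i - 1) \<and> s (i - 1) \<le> m - \<delta> - i - 1"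
        using pos[of "i - 1"] left_bounds[of "i - 1"] s0 d by auto
    qed
    moreover have "\<forall>j. 1 \<le> j \<and> j \<le> \<delta> \<longrightarrow> 0 < s (m - j) \<and> \<delta> + 1 - j \<le> s (m - j) \<and> s (m - j) \<le> m - j - \<alpha> - 1"
    proof (intro allI impI)
      fix j assume j: "1 \<le> j \<and> j \<le> \<delta>"
      then show "0 < s (m - j) \<and> \<delta> + 1 - j \<le> s (m - j) \<and> s (m - j) \<le> m - j - \<alpha> - 1"
        using pos'[of "j - 1"] right_bounds[of "j - 1"] s'0 by (auto simp: s'_def algebra_simps)
    qed
    moreover have "\<alpha> + \<delta> \<le> m - 2" using au by (simp add: \<delta>_def)
    moreover have "chord_set m 0 s = bpath m \<alpha> (m - \<delta>)
      \<union> {edge m (i - 1 - s (i - 1)) (i + s (i - 1)) | i. 1 \<le> i \<and> i \<le> \<alpha>}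
      \<union> {edge m (m - j - s (m - j)) (m - j + 1 + s (m - j)) | j. 1 \<le> j \<and> j \<le> \<delta>}"
      using split chords_zero[of \<alpha> "m - \<delta>" s m] zeros by simp
    ultimately have "chord_set m 0 s \<in> classA m"
      unfolding classA_def using a(1) d(1) dec inc ends
      by (intro CollectI exI[of _ \<alpha>] exI[of _ \<delta>] exI[of _ "\<lambda>i. s (i - 1)"] exI[of _ "\<lambda>j. s (m - j)"]) simp
    then show ?thesis ..
  next
    case True
    then obtain g where g: "\<alpha> < g" "g < \<mu>" "s g \<noteq> 0" by blast
    have no2: "False" if "\<alpha> < j" "j < l" "l < \<mu>" "s j \<noteq> 0" "s l \<noteq> 0" for j l
      using interior[of j l] left_gap[of j] right_gap[of l] that a u by auto
    have zeros: "s t = 0" if "\<alpha> \<le> t" "t < m - \<delta>" "t \<noteq> g" for t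
    proof (rule ccontr)
      assume nz: "s t \<noteq> 0"
      then have "t \<noteq> \<alpha>" "t \<noteq> \<mu>" using a u by auto
      then have "\<alpha> < t" "t < \<mu>" using that d by auto
      then show False using no2[of t g] no2[of g t] nz g that(3) by linarith
    qed
    define \<beta> \<gamma> where "\<beta> = g - \<alpha>" and "\<gamma> = \<mu> - g"
    have sg: "0 < s g" using s[of g] g a u by auto
    have "s (g - 1) = 0" "s (g + 1) = 0" using zeros[of "g - 1"] zeros[of "g + 1"] g d by auto
    \<comment> \<open>The isolated value at \<open>g\<close> is an ascent followed by a descent. The
      zeros it forces on both sides must lie between \<alpha> and \<mu>, which bounds
      \<open>s g\<close>.\<close>
    then have "0 \<le> g - 1 - s g \<and> s (g - 1 - s g) = 0" "g + s g + 1 < m \<and> s (g + s g + 1) = 0"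
      using ascent[of "g - 1" "s g"] descent[of g "s g"] g a u sg by auto
    then have eta: "s g \<le> \<beta> - 1" "s g \<le> \<gamma> - 1"
      using a_least[of "g - 1 - s g"] u_greatest[of "g + s g + 1"] g a u sg by (auto simp: \<beta>_def \<gamma>_def)
    have "\<forall>i. 1 \<le> i \<and> i \<le> \<alpha> \<longrightarrow> 0 < s (i - 1) \<and> s (i - 1) < \<alpha> + \<beta> - 1"
    proof (intro allI impI)
      fix i assume i: "1 \<le> i \<and> i \<le> \<alpha>"
      then show "0 < s (i - 1) \<and> s (i - 1) < \<alpha> + \<beta> - 1"
        using pos[of "i - 1"] left_bounds[of "i - 1"] left_gap[of g] g by (auto simp: \<beta>_def)
    qed
    moreover have "\<forall>j. 1 \<le> j \<and> j \<le> \<delta> \<longrightarrow> 0 < s (m - j) \<and> s (m - j) < \<gamma> + \<delta> - 1"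
    proof (intro allI impI)
      fix j assume j: "1 \<le> j \<and> j \<le> \<delta>"
      then show "0 < s (m - j) \<and> s (m - j) < \<gamma> + \<delta> - 1"
        using pos'[of "j - 1"] right_bounds[of "j - 1"] right_gap[of g] g
        by (auto simp: s'_def \<gamma>_def \<delta>_def algebra_simps)
    qed
    moreover have "chord_set m 0 s = bpath m \<alpha> (\<alpha> + \<beta>) \<union> bpath m (\<alpha> + \<beta> + 1) (m - \<delta>)
      \<union> {edge m (\<alpha> + \<beta> - s g) (\<alpha> + \<beta> + 1 + s g)}
      \<union> {edge m (i - 1 - s (i - 1)) (i + s (i - 1)) | i. 1 \<le> i \<and> i \<le> \<alpha>}
      \<union> {edge m (m - j - s (m - j)) (m - j + 1 + s (m - j)) | j. 1 \<le> j \<and> j \<le> \<delta>}"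
      using split chords_one_nonzero[of \<alpha> "m - \<delta>" g s m] zeros g d by (simp add: \<beta>_def)
    moreover have "2 \<le> \<beta>" "2 \<le> \<gamma>" "\<alpha> + \<delta> \<le> m - 5" "\<beta> + \<gamma> = m - \<alpha> - \<delta> - 1"
      "1 \<le> s g" "s g \<le> min (\<beta> - 1) (\<gamma> - 1)"
      using eta sg by (auto simp: \<beta>_def \<gamma>_def \<delta>_def)
    ultimately have "chord_set m 0 s \<in> classB m"
      unfolding classB_def using a(1) d(1) dec inc
      by (intro CollectI exI[of _ \<alpha>] exI[of _ \<delta>] exI[of _ \<beta>] exI[of _ \<gamma>] exI[of _ "s g"]
        exI[of _ "\<lambda>i. s (i - 1)"] exI[of _ "\<lambda>j. s (m - j)"] conjI)
    then show ?thesis ..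
  qed
qed

lemma rotate_chord_set: "rotate_edges m a (chord_set m 0 s) = chord_set m a s"
proof -
  have "(\<lambda>x. (x + a) mod npts m) ` chord m t r = chord m (a + t) r" for t r
    by (simp add: chord_def edge_def mod_simps algebra_simps)
  then show ?thesis
    unfolding rotate_edges_def chord_set_def setcompr_eq_image image_image by simp
qed

section \<open>Paths along the spine\<close>

definition avoids :: "int \<Rightarrow> (nat \<Rightarrow> int) \<Rightarrow> int set set \<Rightarrow> bool" where
  "avoids m h B \<longleftrightarrow> (\<forall>k. int k + 1 < npts m \<longrightarrow> edge m (wvert h k) (wvert h (Suc k)) \<notin> B)"

lemma edge_commute: "edge m x y = edge m y x"
  by (auto simp: edge_def)

text \<open>Used in two ways: a boundary edge in \<open>B\<close> forbids two equal moves, and a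
  longer chord in \<open>B\<close> forbids a turn.\<close>

lemma avoidsD:
  assumes "avoids m h B" "int k + 1 < npts m"
  shows "h (Suc k) = h k + 1 \<Longrightarrow> h (Suc (Suc k)) = h k + 2 \<Longrightarrow> edge m (h k + 1) (h k + 2) \<notin> B"
    and "h (Suc k) = h k + 1 \<Longrightarrow> h (Suc (Suc k)) = h k + 1 \<Longrightarrow> edge m (h k - int k) (h k + 1) \<notin> B"
    and "h (Suc k) = h k \<Longrightarrow> h (Suc (Suc k)) = h k + 1 \<Longrightarrow> edge m (h k - int k) (h k + 1) \<notin> B"
    and "h (Suc k) = h k \<Longrightarrow> h (Suc (Suc k)) = h k \<Longrightarrow> edge m (h k - int k - 1) (h k - int k) \<notin> B"
proof -
  have e: "edge m (wvert h k) (wvert h (Suc k)) \<notin> B" "edge m (wvert h (Suc k)) (wvert h k) \<notin> B"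
    using assms edge_commute unfolding avoids_def by metis+
  show "h (Suc k) = h k + 1 \<Longrightarrow> h (Suc (Suc k)) = h k + 2 \<Longrightarrow> edge m (h k + 1) (h k + 2) \<notin> B"
    using e(1) by (simp add: wvert_def add.commute)
  show "h (Suc k) = h k + 1 \<Longrightarrow> h (Suc (Suc k)) = h k + 1 \<Longrightarrow> edge m (h k - int k) (h k + 1) \<notin> B"
    using e(2) by (simp add: wvert_def)
  show "h (Suc k) = h k \<Longrightarrow> h (Suc (Suc k)) = h k + 1 \<Longrightarrow> edge m (h k - int k) (h k + 1) \<notin> B"
    using e(1) by (simp add: wvert_def)
  show "h (Suc k) = h k \<Longrightarrow> h (Suc (Suc k)) = h k \<Longrightarrow> edge m (h k - int k - 1) (h k - int k) \<notin> B"
    using e(2) by (simp add: wvert_def algebra_simps)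
qed

text \<open>As long as the right end of the visited interval stays on the spine, the walk has to turn at
  every spine vertex \<open>t\<close>, and it uses two edges at \<open>t\<close> whose directions are consecutive; the leaf edges
  at \<open>t\<close> block these directions, so that the sum of the two ends of the interval drops below them.\<close>
lemma spine_sum_bound:
  fixes s :: "int \<Rightarrow> int"
  assumes walk: "walk h" and av: "avoids m h B" and N: "int N = npts m"
    and start: "h 0 < \<alpha>" and finish: "M \<le> h N"
    and spine: "\<And>t. \<alpha> \<le> t \<Longrightarrow> t < M \<Longrightarrow> edge m t (t + 1) \<in> B"
    and leaf: "\<And>t. 0 \<le> t \<Longrightarrow> t < \<alpha> \<Longrightarrow> chord m t (s t) \<in> B"
    and dec: "\<And>t. 0 \<le> t \<Longrightarrow> t + 1 < \<alpha> \<Longrightarrow> s (t + 1) < s t"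
    and pos: "\<And>t. 0 \<le> t \<Longrightarrow> t < \<alpha> \<Longrightarrow> 0 < s t"
    and k: "k \<le> N" "\<alpha> \<le> h k" "h k < M"
    and \<tau>: "0 \<le> \<tau>" "\<tau> = \<alpha> \<or> \<tau> < \<alpha> \<and> \<tau> + 1 + s \<tau> \<le> h k"
  shows "2 * h k - int k + 1 \<le> 2 * \<tau>"
  using k \<tau>
proof (induction k arbitrary: \<tau> rule: less_induct)
  case (less k)
  have "k \<noteq> 0" using less.prems start by (cases k) auto
  then obtain j where j: "k = Suc j" by (cases k) auto
  \<comment> \<open>Two successive right moves on the spine would use a spine edge, so a right move
    between spine vertices has left moves before and after it.\<close>
  have noRR: False if "Suc i < N" "h (Suc i) = h i + 1" "h (Suc (Suc i)) = h (Suc i) + 1"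
    "\<alpha> \<le> h (Suc i)" "h (Suc i) < M" for i
    using avoidsD(1)[OF av, of i] spine[of "h (Suc i)"] that N by (simp add: add.commute)
  consider (L) "h k = h j" | (R) "h k = h j + 1" using walkD[OF walk, of j] j by auto
  then show ?case
  proof cases
    case L
    then show ?thesis using less.IH[of j \<tau>] less.prems j by auto
  next
    case R
    show ?thesis
    proof (cases "\<alpha> \<le> h j")
      case False
      then have "h k = \<alpha>" using R less.prems by simp
      moreover have "\<tau> = \<alpha>"
        using strict_decrease_bounds(1)[of \<alpha> s \<tau>] dec pos less.prems \<open>h k = \<alpha>\<close> by auto
      ultimately show ?thesis using j by simp
    next
      case True
      then have "j \<noteq> 0" using start by (cases j) auto
      then obtain i where i: "j = Suc i" by (cases j) auto
      have hi: "h j = h i"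
        using noRR[of i] walkD[OF walk, of i] R True less.prems i j by auto
      have kN: "k < N" using less.prems finish by (cases "k = N") auto
      have next_L: "h (Suc k) = h k"
        using noRR[of j] walkD[OF walk, of k] R kN less.prems j finish
        by (cases "Suc k = N") auto
      have old: "2 * h k - int k + 1 \<le> 2 * \<rho>"
        if "0 \<le> \<rho>" "\<rho> = \<alpha> \<or> \<rho> < \<alpha> \<and> \<rho> + 1 + s \<rho> \<le> h i" for \<rho>
        using less.IH[of i \<rho>] that True hi R less.prems i j by auto
      \<comment> \<open>The edges into and out of vertex \<open>h k\<close> have sums
        \<open>2 h k - k + 1\<close> and \<open>2 h k - k\<close>. If the chord over \<rho> ends at
        \<open>h k\<close>, neither sum can be \<open>2 \<rho> + 1\<close>, so the bound
        \<open>2 \<rho> + 2\<close> improves to \<open>2 \<rho>\<close>.\<close>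
      have step: "2 * h k - int k + 1 \<le> 2 * \<rho>"
        if \<rho>: "0 \<le> \<rho>" "\<rho> < \<alpha>" "\<rho> + 1 + s \<rho> = h k" "2 * h k - int k + 1 \<le> 2 * (\<rho> + 1)" for \<rho>
      proof -
        have c: "edge m (\<rho> - s \<rho>) (h k) \<in> B" using leaf[OF \<rho>(1,2)] \<rho>(3) by (simp add: chord_def)
        have "2 * h k - int k + 1 \<noteq> 2 * \<rho> + 1"
        proof
          assume "2 * h k - int k + 1 = 2 * \<rho> + 1"
          then have "\<rho> - s \<rho> = h i - int i" using \<rho>(3) hi R i j by simp
          then show False using avoidsD(3)[OF av, of i] c hi R i j kN N by simp
        qed
        moreover have "2 * h k - int k + 1 \<noteq> 2 * \<rho> + 2"
        proof
          assume "2 * h k - int k + 1 = 2 * \<rho> + 2"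
          then have "\<rho> - s \<rho> = h j - int j" using \<rho>(3) R j by simp
          then show False using avoidsD(2)[OF av, of j] c R j kN N next_L by simp
        qed
        ultimately show ?thesis using \<rho>(4) by presburger
      qed
      \<comment> \<open>Downward induction on \<rho> from \<alpha>. The chord over
        \<open>\<rho> + 1\<close> ends no further right than that over \<rho>, so its bound is
        available. If the chord over \<rho> ends before \<open>h k\<close>, the bound at step
        \<open>i\<close> applies, as the sum is the same at \<open>i\<close> and
        \<open>k\<close>.\<close>
      have "2 * h k - int k + 1 \<le> 2 * \<rho>"
        if "d = nat (\<alpha> - \<rho>)" "0 \<le> \<rho>" "\<rho> = \<alpha> \<or> \<rho> < \<alpha> \<and> \<rho> + 1 + s \<rho> \<le> h k" for d \<rho>
        using that
      proof (induction d arbitrary: \<rho>)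
        case 0
        then show ?case using old[of \<rho>] by auto
      next
        case (Suc d)
        then have \<rho>: "\<rho> < \<alpha>" "\<rho> + 1 + s \<rho> \<le> h k" by auto
        have "\<rho> + 1 = \<alpha> \<or> \<rho> + 1 < \<alpha> \<and> \<rho> + 1 + 1 + s (\<rho> + 1) \<le> h k"
          using \<rho> dec[of \<rho>] Suc.prems by auto
        then have "2 * h k - int k + 1 \<le> 2 * (\<rho> + 1)"
          using Suc.prems Suc.IH[of "\<rho> + 1"] by auto
        then show ?case
          using step[of \<rho>] old[of \<rho>] \<rho> Suc.prems hi R by (cases "\<rho> + 1 + s \<rho> = h k") auto
      qed
      then show ?thesis using less.prems by blast
    qed
  qed
qed

section \<open>Reflection and reversal\<close>

lemma reflect_chord:
  "(\<lambda>x. (m - x) mod npts m) ` chord m t r = chord m (m - 1 - t) r"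
proof -
  have "m - 1 - t + 1 + r = m - (t - r)" "m - 1 - t - r = m - (t + 1 + r)" by simp_all
  then show ?thesis
    unfolding chord_def edge_def by (simp only: image_insert image_empty mod_diff_right_eq insert_commute)
qed

lemma boundary_edge_chord: "edge m t (t + 1) = chord m t 0"
  by (simp add: chord_def)

text \<open>Reversing a walk and reflecting the polygon by \<open>x \<mapsto> m - x\<close> gives the walk
  \<open>k \<mapsto> m - 1 - h (n - k)\<close>; this exchanges the two ends of a spine.\<close>
lemma reflected_reverse:
  assumes "B \<subseteq> edges m" "walk h" "avoids m h B" "int N = npts m"
  defines "h' \<equiv> \<lambda>k. m - 1 - h (N - k)"
  shows "walk h'" "avoids m h' ((`) (\<lambda>x. (m - x) mod npts m) ` B)"
proof -
  show walk': "walk h'"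
    unfolding walk_def
  proof
    fix k
    show "h' (Suc k) = h' k \<or> h' (Suc k) = h' k + 1"
    proof (cases "k < N")
      case True
      then have "N - k = Suc (N - Suc k)" by simp
      then show ?thesis using walkD[OF assms(2), of "N - Suc k"] by (auto simp: h'_def)
    qed (simp add: h'_def)
  qed
  let ?r = "\<lambda>x. (m - x) mod npts m"
  \<comment> \<open>Reversal replaces the visited interval by its complement; this is why the lifts
    differ by exactly \<open>n\<close> at a left move and agree at a right move.\<close>
  have vert: "wvert h' k mod npts m = ?r (wvert h i)" if i: "i + Suc k = N" for i k
  proof -
    have Nk: "N - k = Suc i" "N - Suc k = i" and int_i: "int i = npts m - 1 - int k"
      using i assms(4) by auto
    show ?thesis
    proof (cases "h (Suc i) = h i")
      case True
      then have "wvert h' k = m - 1 - h i - int k" by (simp add: wvert_def h'_def Nk)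
      moreover have "m - wvert h i = m - 1 - h i - int k + npts m"
        using True int_i by (simp add: wvert_def)
      ultimately have "m - wvert h i = wvert h' k + npts m" by simp
      then show ?thesis by (metis mod_add_self2)
    next
      case False
      then have "h (Suc i) = h i + 1" using walkD[OF assms(2), of i] by auto
      then show ?thesis by (simp add: wvert_def h'_def Nk diff_diff_eq)
    qed
  qed
  show "avoids m h' ((`) ?r ` B)"
    unfolding avoids_def
  proof (intro allI impI notI)
    fix k assume k: "int k + 1 < npts m" "edge m (wvert h' k) (wvert h' (Suc k)) \<in> (`) ?r ` B"
    define i where "i = N - 2 - k"
    have kN: "Suc k < N" using k assms(4) by linarith
    then have i: "Suc i + Suc k = N" "i + Suc (Suc k) = N" by (auto simp: i_def)
    obtain e where e: "e \<in> B" "edge m (wvert h' k) (wvert h' (Suc k)) = ?r ` e" using k(2) by blast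
    have rr: "?r (?r x) = x mod npts m" for x by (simp add: mod_diff_right_eq)
    have "?r ` ?r ` e = (\<lambda>x. x) ` e"
      unfolding image_image
    proof (rule image_cong)
      fix x assume "x \<in> e"
      then show "?r (?r x) = x"
        using rr[of x] e(1) assms(1) by (auto simp: edges_def verts_def)
    qed simp
    moreover have "?r ` edge m (wvert h' k) (wvert h' (Suc k)) = edge m (wvert h i) (wvert h (Suc i))"
      using vert[OF i(1)] vert[OF i(2)] rr unfolding edge_def
      by (simp add: insert_commute)
    ultimately have "edge m (wvert h i) (wvert h (Suc i)) = e" using e(2) by simp
    moreover have "int i + 1 < npts m" using kN assms(4) by (simp add: i_def)
    ultimately show False using assms(3) e(1) by (auto simp: avoids_def)
  qed
qed

text \<open>This is \<open>spine_sum_bound\<close> for the reflected reverse with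
  \<open>\<tau> = 0\<close>, the place of the chord over \<open>m - 1\<close>. Expressed in
  \<open>h\<close>, the upper bound becomes a lower bound on \<open>h k\<close>.\<close>

lemma reflected_spine_sum_bound:
  fixes s :: "int \<Rightarrow> int"
  assumes B: "B \<subseteq> edges m" and walk: "walk h" and av: "avoids m h B" and N: "int N = npts m"
    and start: "m - \<delta> \<le> h N" and finish: "h 0 < M" and \<delta>: "0 \<le> \<delta>"
    and spine: "\<And>t. M \<le> t \<Longrightarrow> t < m - \<delta> \<Longrightarrow> edge m t (t + 1) \<in> B"
    and leaf: "\<And>t. m - \<delta> \<le> t \<Longrightarrow> t < m \<Longrightarrow> chord m t (s t) \<in> B"
    and inc: "\<And>t. m - \<delta> \<le> t \<Longrightarrow> t + 1 < m \<Longrightarrow> s t < s (t + 1)"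
    and pos: "\<And>t. m - \<delta> \<le> t \<Longrightarrow> t < m \<Longrightarrow> 0 < s t"
    and k: "k \<le> N" "M \<le> h k" "h k < m - \<delta>" "\<delta> = 0 \<or> h k \<le> m - 2 - s (m - 1)"
  shows "int k \<le> 2 * h k"
proof -
  define h' where "h' k = m - 1 - h (N - k)" for k
  define B' where "B' = (`) (\<lambda>x. (m - x) mod npts m) ` B"
  define s' where "s' t = s (m - 1 - t)" for t
  have h': "walk h'" "avoids m h' B'"
    using reflected_reverse[OF B walk av N] by (simp_all add: h'_def[abs_def] B'_def)
  have reflect: "chord m t r \<in> B'" if "chord m (m - 1 - t) r \<in> B" for t r
    using imageI[OF that, of "(`) (\<lambda>x. (m - x) mod npts m)"] by (simp add: B'_def reflect_chord)
  have "2 * h' (N - k) - int (N - k) + 1 \<le> 2 * 0"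
  proof (rule spine_sum_bound[OF h' N, where \<alpha> = \<delta> and M = "m - M" and s = s'])
    show "h' 0 < \<delta>" using start by (simp add: h'_def)
    show "m - M \<le> h' N" using finish by (simp add: h'_def)
    show "edge m t (t + 1) \<in> B'" if "\<delta> \<le> t" "t < m - M" for t
      using reflect[of t 0] spine[of "m - 1 - t"] that unfolding boundary_edge_chord by simp
    show "chord m t (s' t) \<in> B'" if "0 \<le> t" "t < \<delta>" for t
      using reflect[of t "s' t"] leaf[of "m - 1 - t"] that by (simp add: s'_def)
    show "s' (t + 1) < s' t" if "0 \<le> t" "t + 1 < \<delta>" for t
    proof -
      have "m - 1 - (t + 1) + 1 = m - 1 - t" by simp
      then show ?thesis using inc[of "m - 1 - (t + 1)"] that by (simp only: s'_def)
    qed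
    show "0 < s' t" if "0 \<le> t" "t < \<delta>" for t
      using pos[of "m - 1 - t"] that by (simp add: s'_def)
    show "\<delta> \<le> h' (N - k)" "h' (N - k) < m - M" using k by (auto simp: h'_def)
    show "0 = \<delta> \<or> 0 < \<delta> \<and> 0 + 1 + s' 0 \<le> h' (N - k)" using k \<delta> by (auto simp: h'_def s'_def)
  qed auto
  then show ?thesis using k N by (simp add: h'_def npts_def)
qed

lemma walk_reaches:
  assumes "walk h" "h 0 < g" "g \<le> h N"
  shows "\<exists>k<N. h k = g - 1 \<and> h (Suc k) = g"
proof -
  obtain k where k: "k < N" "(h k < g) \<noteq> (h (Suc k) < g)"
    using predicate_switch[of 0 N "\<lambda>k. h k < g"] assms(2,3) by auto
  then show ?thesis using walkD[OF assms(1), of k] by (intro exI[of _ k]) auto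
qed

section \<open>End vertices and orientation of an avoiding path\<close>

definition path_avoids :: "int list \<Rightarrow> int set set \<Rightarrow> bool" where
  "path_avoids p B \<longleftrightarrow> (\<forall>i. i + 1 < length p \<longrightarrow> path_edge p i \<notin> B)"

lemma path_edge_rev:
  assumes "i + 1 < length p"
  obtains j where "j + 1 < length p" "path_edge (rev p) i = path_edge p j"
proof -
  obtain j where j: "length p = i + j + 2" using assms less_imp_Suc_add[of "i + 1" "length p"] by auto
  then have "path_edge (rev p) i = path_edge p j"
    by (auto simp: path_edge_def rev_nth)
  then show ?thesis using that[of j] j by simp
qed

lemma is_SHP_rev:
  assumes "is_SHP m p"
  shows "is_SHP m (rev p)"
proof -
  have "\<not> crosses (path_edge (rev p) i) (path_edge (rev p) j)"
    if "i + 1 < length p" "j + 1 < length p" for i j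
    using path_edge_rev[OF that(1)] path_edge_rev[OF that(2)] assms unfolding is_SHP_def by metis
  then show ?thesis using assms by (simp add: is_SHP_def)
qed

lemma path_avoids_rev:
  assumes "path_avoids p B"
  shows "path_avoids (rev p) B"
  using assms path_edge_rev unfolding path_avoids_def length_rev by metis

lemma path_avoids_walk:
  assumes "m \<ge> 2" "is_SHP m p" "path_avoids p B" "v mod npts m = p ! 0"
  obtains h where "walk h" "avoids m h B" "h 0 = v - 1" "h 1 = v"
    "h (nat (npts m)) = h (nat (npts m) - 1) + 1" "h (nat (npts m)) mod npts m = p ! (nat (npts m) - 1)"
proof -
  obtain h where h: "walk h" "h 0 = v - 1" "h 1 = v" "h (nat (npts m)) = h (nat (npts m) - 1) + 1"
    "p = wpath m h"
    using SHP_is_walk[OF assms(1,2,4)] by blast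
  have n: "npts m \<ge> 3" using npts_ge_3[OF assms(1)] .
  have "avoids m h B"
    unfolding avoids_def
  proof (intro allI impI)
    fix k assume "int k + 1 < npts m"
    then have k: "k + 1 < nat (npts m)" by linarith
    then show "edge m (wvert h k) (wvert h (Suc k)) \<notin> B"
      using assms(3) wpath_edge[OF k, of h] unfolding path_avoids_def h(5) length_wpath by auto
  qed
  moreover have "wvert h (nat (npts m) - 1) = h (nat (npts m))"
    using h(4) n by (simp add: wvert_def)
  then have "h (nat (npts m)) mod npts m = p ! (nat (npts m) - 1)"
    using wpath_nth[of "nat (npts m) - 1" m h] n by (simp add: h(5))
  ultimately show ?thesis using that h by blast
qed

text \<open>The second vertex is a neighbour of the first on the polygon, so a path always uses one
  of the two boundary edges at its start.\<close>

lemma spine_interior_not_start: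
  assumes "m \<ge> 2" "is_SHP m p" "path_avoids p B" "edge m (t - 1) t \<in> B" "edge m t (t + 1) \<in> B"
  shows "t mod npts m \<noteq> p ! 0"
proof
  assume "t mod npts m = p ! 0"
  then obtain h where h: "walk h" "avoids m h B" "h 0 = t - 1" "h 1 = t"
    using path_avoids_walk[OF assms(1-3)] by blast
  then show False
    using avoidsD(1,2)[OF h(2), of 0] walkD[OF h(1), of 1] assms(4,5) npts_ge_3[OF assms(1)]
    by (auto simp: add.commute)
qed

lemma last_eq_rev_first:
  assumes "m \<ge> 2" "is_SHP m p"
  shows "rev p ! 0 = p ! (nat (npts m) - 1)" "rev p ! (nat (npts m) - 1) = p ! 0"
  using is_SHP_length[OF assms(2)] npts_ge_3[OF assms(1)] by (simp_all add: rev_nth)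

text \<open>The walk codes the path itself or its reverse.\<close>
lemma spine_on_right_side:
  assumes "m \<ge> 2" "is_SHP m p" "path_avoids p B"
    and interior: "\<And>t. \<alpha> < t \<Longrightarrow> t < M \<Longrightarrow> t mod npts m \<noteq> p ! 0 \<and> t mod npts m \<noteq> p ! (nat (npts m) - 1)"
  obtains h where "walk h" "avoids m h B" "h 0 < \<alpha>" "M \<le> h (nat (npts m))"
proof -
  define n where "n = npts m"
  define N where "N = nat n"
  have n: "n \<ge> 3" "int N = n" "N = Suc (N - 1)" "1 \<le> N - 1"
    using npts_ge_3[OF assms(1)] by (auto simp: n_def N_def)
  \<comment> \<open>The lift of the first vertex with
    \<open>\<alpha> - n < v \<le> \<alpha>\<close>.\<close>
  define v where "v = \<alpha> - (\<alpha> - p ! 0) mod n"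
  have "p ! 0 \<in> set p" using is_SHP_length[OF assms(2)] n by (intro nth_mem) (simp add: n_def)
  then have p0: "p ! 0 mod n = p ! 0" using assms(2) by (simp add: is_SHP_def verts_def n_def)
  have v: "v mod n = p ! 0" "v \<le> \<alpha>" "\<alpha> < v + n"
    using n p0 pos_mod_sign[of n "\<alpha> - p ! 0"] pos_mod_bound[of n "\<alpha> - p ! 0"]
    by (auto simp: v_def mod_diff_right_eq)
  have ends: "h N \<in> {v + 1..v + n - 1}" if "walk h" "h 0 = v - 1" "h 1 = v" "h N = h (N - 1) + 1" for h v
    using that walk_mono[OF that(1), of 1 "N - 1"] walk_mono[OF that(1), of 0 N] n by auto
  obtain h where h: "walk h" "avoids m h B" "h 0 = v - 1" "h 1 = v" "h N = h (N - 1) + 1"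
      "h N mod n = p ! (N - 1)"
    using path_avoids_walk[OF assms(1-3), of v] v unfolding n_def N_def by blast
  show ?thesis
  proof (cases "M \<le> h N")
    case True
    then show ?thesis using that[of h] h v by (simp add: N_def n_def)
  next
    case False
    \<comment> \<open>A last vertex below \<open>M\<close> is not inside the spine, hence is at most
      \<alpha>. The reverse path starts there and ends at \<open>v + n\<close>, which exceeds
      \<alpha> and therefore is at least \<open>M\<close>.\<close>
    then have w: "h N \<le> \<alpha>" using interior[of "h N"] h(6) by (force simp: n_def N_def)
    have Mv: "M \<le> v + n" using interior[of "v + n"] v by (force simp: n_def)
    have r: "is_SHP m (rev p)" "path_avoids (rev p) B" "h N mod npts m = rev p ! 0"
      using is_SHP_rev[OF assms(2)] path_avoids_rev[OF assms(3)] last_eq_rev_first[OF assms(1,2)] h(6)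
      by (simp_all add: n_def N_def)
    obtain h' where h': "walk h'" "avoids m h' B" "h' 0 = h N - 1" "h' 1 = h N" "h' N = h' (N - 1) + 1"
      "h' N mod n = rev p ! (N - 1)"
      using path_avoids_walk[OF assms(1) r] unfolding n_def N_def by blast
    have "h' N mod n = (v + n) mod n"
      using h'(6) v last_eq_rev_first[OF assms(1,2)] by (simp add: n_def N_def)
    moreover have "\<bar>h' N - (v + n)\<bar> < n"
      using ends[OF h'(1,3-5)] ends[OF h(1,3-5)] by auto
    ultimately have "h' N = v + n" by (rule mod_eq_imp_eq)
    then show ?thesis using that[of h'] h' w Mv by (simp add: N_def n_def)
  qed
qed

text \<open>A path that starts in the gap between the two spines is forced to zigzag until it uses the
  chord above the gap.\<close>
lemma no_start_in_gap:
  assumes m: "m \<ge> 2" and p: "is_SHP m p" "path_avoids p B"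
    and left: "\<And>t. g - \<beta> \<le> t \<Longrightarrow> t < g \<Longrightarrow> edge m t (t + 1) \<in> B"
    and right: "\<And>t. g + 1 \<le> t \<Longrightarrow> t < g + 1 + \<gamma> \<Longrightarrow> edge m t (t + 1) \<in> B"
    and \<eta>: "1 \<le> \<eta>" "\<eta> \<le> \<beta> - 1" "\<eta> \<le> \<gamma> - 1" "\<eta> \<le> m - 2" and chord: "chord m g \<eta> \<in> B"
  shows "p ! 0 \<noteq> g mod npts m" "p ! 0 \<noteq> (g + 1) mod npts m"
proof -
  show "p ! 0 \<noteq> g mod npts m"
  proof
    assume "p ! 0 = g mod npts m"
    then obtain h where h: "walk h" "avoids m h B" "h 0 = g - 1" "h 1 = g"
      using path_avoids_walk[OF m p] by metis
    \<comment> \<open>The path crosses the gap first, and from then on the spine edges forbid equal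
      moves: it runs through \<open>g\<close>, \<open>g + 1\<close>, \<open>g - 1\<close>,
      \<open>g + 2\<close>, and so on.\<close>
    have forced: "h (2 * j) = g + int j \<and> h (Suc (2 * j)) = g + int j" if "1 \<le> j" "int j \<le> \<eta>" for j
      using that
    proof (induction j)
      case (Suc j)
      have turn: "h (2 * Suc j) = g + int (Suc j)"
      proof (cases "j = 0")
        case True
        then show ?thesis
          using avoidsD(2)[OF h(2), of 0] walkD[OF h(1), of 1] left[of "g - 1"] h(3,4) \<eta> m
          by (auto simp: npts_def numeral_2_eq_2)
      next
        case False
        then have hj: "h (2 * j) = g + int j" "h (Suc (2 * j)) = g + int j" using Suc by auto
        then show ?thesis
          using avoidsD(4)[OF h(2), of "2 * j"] walkD[OF h(1), of "Suc (2 * j)"]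
            left[of "g - int j - 1"] Suc.prems \<eta>
          by (auto simp: npts_def)
      qed
      have "h (Suc (2 * j)) = g + int j" using Suc h(4) by (cases "j = 0") auto
      then have "h (Suc (2 * Suc j)) = g + int (Suc j)"
        using avoidsD(1)[OF h(2), of "Suc (2 * j)"] walkD[OF h(1), of "2 * Suc j"] turn
          right[of "g + int j + 1"] Suc.prems \<eta>
        by (auto simp: npts_def algebra_simps)
      then show ?case using turn by simp
    qed simp
    \<comment> \<open>At \<open>j = \<eta>\<close> the path stands at \<open>g - \<eta>\<close>,
      where a right move uses the chord over the gap and a left move a spine edge.\<close>
    define j where "j = nat \<eta>"
    have j: "1 \<le> j" "int j = \<eta>" using \<eta> by (auto simp: j_def)
    have hj: "h (2 * j) = g + \<eta>" "h (Suc (2 * j)) = g + \<eta>" using forced[of j] j by auto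
    have "edge m (g - \<eta>) (g + \<eta> + 1) \<in> B" "edge m (g - \<eta> - 1) (g - \<eta>) \<in> B"
      using chord left[of "g - \<eta> - 1"] \<eta> by (auto simp: chord_def algebra_simps)
    then show False
      using avoidsD(3,4)[OF h(2), of "2 * j"] walkD[OF h(1), of "Suc (2 * j)"] hj j \<eta>
      by (auto simp: npts_def algebra_simps)
  qed
  show "p ! 0 \<noteq> (g + 1) mod npts m"
  proof
    assume "p ! 0 = (g + 1) mod npts m"
    then obtain h where h: "walk h" "avoids m h B" "h 0 = g + 1 - 1" "h 1 = g + 1"
      using path_avoids_walk[OF m p] by metis
    \<comment> \<open>Now the order is \<open>g + 1\<close>, \<open>g\<close>, \<open>g + 2\<close>,
      \<open>g - 1\<close>, and so on. The path is caught at \<open>g + \<eta> + 1\<close>, where a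
      left move uses the chord and a right move a spine edge.\<close>
    have forced: "h (Suc (2 * j)) = g + int j + 1 \<and> h (Suc (Suc (2 * j))) = g + int j + 1"
      if "int j < \<eta>" for j
      using that
    proof (induction j)
      case 0
      then show ?case
        using avoidsD(1)[OF h(2), of 0] walkD[OF h(1), of 1] right[of "g + 1"] h(3,4) \<eta> m
        by (auto simp: npts_def algebra_simps)
    next
      case (Suc j)
      then have hj: "h (Suc (2 * j)) = g + int j + 1" "h (Suc (Suc (2 * j))) = g + int j + 1" by auto
      then have turn: "h (Suc (2 * Suc j)) = g + int j + 2"
        using avoidsD(4)[OF h(2), of "Suc (2 * j)"] walkD[OF h(1), of "Suc (Suc (2 * j))"]
          left[of "g - int j - 1"] Suc.prems \<eta>
        by (auto simp: npts_def algebra_simps)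
      then have "h (Suc (Suc (2 * Suc j))) = g + int j + 2"
        using avoidsD(1)[OF h(2), of "Suc (Suc (2 * j))"] walkD[OF h(1), of "Suc (2 * Suc j)"] hj
          right[of "g + int j + 2"] Suc.prems \<eta>
        by (auto simp: npts_def algebra_simps)
      then show ?case using turn by simp
    qed
    define j where "j = nat (\<eta> - 1)"
    have j: "int j = \<eta> - 1" using \<eta> by (auto simp: j_def)
    have hj: "h (Suc (2 * j)) = g + \<eta>" "h (Suc (Suc (2 * j))) = g + \<eta>" using forced[of j] j by auto
    have turn: "h (Suc (Suc (Suc (2 * j)))) = g + \<eta> + 1"
      using avoidsD(4)[OF h(2), of "Suc (2 * j)"] walkD[OF h(1), of "Suc (Suc (2 * j))"]
        left[of "g - \<eta>"] hj j \<eta>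
      by (auto simp: npts_def algebra_simps)
    have "edge m (g - \<eta>) (g + \<eta> + 1) \<in> B" "edge m (g + \<eta> + 1) (g + \<eta> + 2) \<in> B"
      using chord right[of "g + \<eta> + 1"] \<eta> by (auto simp: chord_def algebra_simps)
    then show False
      using avoidsD(1,2)[OF h(2), of "Suc (Suc (2 * j))"] walkD[OF h(1), of "Suc (Suc (Suc (2 * j)))"] turn hj j \<eta>
      by (auto simp: npts_def algebra_simps)
  qed
qed

section \<open>The classes consist of blockers\<close>

lemma chord_in_edges:
  assumes "0 \<le> r" "r \<le> m - 2"
  shows "chord m t r \<in> edges m"
proof -
  have "(t - r) mod npts m \<noteq> (t + 1 + r) mod npts m"
    using mod_eq_imp_eq[of "t - r" "npts m" "t + 1 + r"] assms by (auto simp: npts_def)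
  then show ?thesis
    using assms unfolding chord_def edge_def edges_def verts_def
    by (intro CollectI exI conjI) (auto simp: npts_def)
qed

lemma chord_set_image: "chord_set m a s = (\<lambda>t. chord m (a + t) (s t)) ` {0..<m}"
  by (auto simp: chord_set_def)

text \<open>A chord set has at most \<open>m\<close> edges, and no hitting set has fewer.\<close>

lemma chord_set_is_blocker:
  assumes "m \<ge> 2" "\<And>t. 0 \<le> t \<Longrightarrow> t < m \<Longrightarrow> 0 \<le> s t \<and> s t \<le> m - 2"
    "hits_all_SHP m (chord_set m 0 s)"
  shows "is_blocker m (chord_set m 0 s)"
proof -
  have "chord_set m 0 s \<subseteq> edges m"
    using chord_in_edges assms(2) by (auto simp: chord_set_def)
  moreover have "card (chord_set m 0 s) \<le> nat m"
    using card_image_le[of "{0..<m}" "\<lambda>t. chord m (0 + t) (s t)"] by (simp add: chord_set_image)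
  ultimately show ?thesis
    using assms(3) hitting_set_card(1)[OF assms(1)] unfolding is_blocker_def by (meson le_trans)
qed

lemma not_hits_imp_path:
  assumes "\<not> hits_all_SHP m B"
  obtains p where "is_SHP m p" "path_avoids p B"
  using assms unfolding hits_all_SHP_def path_avoids_def by blast

text \<open>The case of class A: for the step \<open>k\<close> from \<open>g - 1\<close> to
  \<open>g = 1 + s 0\<close>, the left bound gives \<open>k \<ge> 2 g\<close> and the right bound
  \<open>k \<le> 2 g - 2\<close>.\<close>

lemma valley_hits_all_SHP:
  fixes s :: "int \<Rightarrow> int"
  assumes m: "m \<ge> 2" and \<alpha>\<delta>: "0 \<le> \<alpha>" "0 \<le> \<delta>" "\<alpha> + \<delta> \<le> m - 2"
    and s: "\<And>t. 0 \<le> t \<Longrightarrow> t < m \<Longrightarrow> 0 \<le> s t \<and> s t \<le> m - 2"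
    and zero: "\<And>t. \<alpha> \<le> t \<Longrightarrow> t < m - \<delta> \<Longrightarrow> s t = 0"
    and dec: "\<And>t. 0 \<le> t \<Longrightarrow> t + 1 < \<alpha> \<Longrightarrow> s (t + 1) < s t"
    and inc: "\<And>t. m - \<delta> \<le> t \<Longrightarrow> t + 1 < m \<Longrightarrow> s t < s (t + 1)"
    and left: "\<And>t. 0 \<le> t \<Longrightarrow> t < \<alpha> \<Longrightarrow> 0 < s t"
    and right: "\<And>t. m - \<delta> \<le> t \<Longrightarrow> t < m \<Longrightarrow> 0 < s t"
    and ends: "s 0 + s (m - 1) \<le> m - 2" "\<alpha> \<le> s 0" "\<delta> \<le> s (m - 1)"
  shows "hits_all_SHP m (chord_set m 0 s)"
proof (rule ccontr)
  define B where "B = chord_set m 0 s"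
  assume "\<not> hits_all_SHP m (chord_set m 0 s)"
  then obtain p where p: "is_SHP m p" "path_avoids p B" unfolding B_def by (rule not_hits_imp_path)
  define N where "N = nat (npts m)"
  have N: "int N = npts m" using npts_ge_3[OF m] by (simp add: N_def)
  have B: "B \<subseteq> edges m" using chord_in_edges s by (auto simp: B_def chord_set_def)
  have leaf: "chord m t (s t) \<in> B" if "0 \<le> t" "t < m" for t using that by (auto simp: B_def chord_set_def)
  have spine: "edge m t (t + 1) \<in> B" if "\<alpha> \<le> t" "t < m - \<delta>" for t
    using leaf[of t] zero[of t] that \<alpha>\<delta> by (simp add: boundary_edge_chord)
  have inner: "t mod npts m \<noteq> p ! 0 \<and> t mod npts m \<noteq> p ! (nat (npts m) - 1)"
    if "\<alpha> < t" "t < m - \<delta>" for t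
    using spine_interior_not_start[OF m p, of t] last_eq_rev_first[OF m p(1)]
      spine_interior_not_start[OF m is_SHP_rev[OF p(1)] path_avoids_rev[OF p(2)], of t]
      spine[of t] spine[of "t - 1"] that by auto
  obtain h where h: "walk h" "avoids m h B" "h 0 < \<alpha>" "m - \<delta> \<le> h N"
    using spine_on_right_side[OF m p inner] unfolding N_def by blast
  \<comment> \<open>Right end of the chord over 0 (the boundary edge \<open>[0, 1]\<close> if
    \<open>\<alpha> = 0\<close>). By \<open>s 0 + s (m - 1) \<le> m - 2\<close> the point
    \<open>g - 1\<close> is still within reach of the right bound.\<close>
  define g where "g = 1 + s 0"
  have g: "\<alpha> < g" "g < m - \<delta>" "\<delta> = 0 \<or> g - 1 \<le> m - 2 - s (m - 1)" "0 = \<alpha> \<or> 0 < \<alpha> \<and> 0 + 1 + s 0 \<le> g"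
    using ends \<alpha>\<delta> s[of 0] s[of "m - 1"] m by (auto simp: g_def)
  obtain k where k: "k < N" "h k = g - 1" "h (Suc k) = g"
    using walk_reaches[OF h(1), of g N] h(3,4) g by auto
  have "2 * h (Suc k) - int (Suc k) + 1 \<le> 2 * 0"
    by (rule spine_sum_bound[OF h(1,2) N h(3,4) spine, where s = s])
      (use leaf dec left g k \<alpha>\<delta> in auto)
  moreover have "int k \<le> 2 * h k"
    by (rule reflected_spine_sum_bound[OF B h(1,2) N h(4,3) \<alpha>\<delta>(2) spine, where s = s])
      (use leaf inc right g k \<alpha>\<delta> in auto)
  ultimately show False using k by simp
qed

text \<open>The case of class B: let \<open>k\<close> and \<open>l\<close> be the steps that enter
  \<open>g\<close> and \<open>g + 1\<close>. The left bound gives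
  \<open>k - 1 \<ge> 2 g - 1\<close>, the right bound \<open>l + 2 \<le> 2 g + 2\<close>, and
  \<open>k < l\<close> contradicts this.\<close>

lemma double_valley_hits_all_SHP:
  fixes s :: "int \<Rightarrow> int"
  assumes m: "m \<ge> 2" and \<alpha>\<delta>: "0 \<le> \<alpha>" "0 \<le> \<delta>"
    and s: "\<And>t. 0 \<le> t \<Longrightarrow> t < m \<Longrightarrow> 0 \<le> s t \<and> s t \<le> m - 2"
    and zero: "\<And>t. \<alpha> \<le> t \<Longrightarrow> t < m - \<delta> \<Longrightarrow> t \<noteq> g \<Longrightarrow> s t = 0"
    and gap: "1 \<le> s g" "\<alpha> + s g < g" "g + s g + 1 < m - \<delta>"
    and dec: "\<And>t. 0 \<le> t \<Longrightarrow> t + 1 < \<alpha> \<Longrightarrow> s (t + 1) < s t"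
    and inc: "\<And>t. m - \<delta> \<le> t \<Longrightarrow> t + 1 < m \<Longrightarrow> s t < s (t + 1)"
    and left: "\<And>t. 0 \<le> t \<Longrightarrow> t < \<alpha> \<Longrightarrow> 0 < s t"
    and right: "\<And>t. m - \<delta> \<le> t \<Longrightarrow> t < m \<Longrightarrow> 0 < s t"
    and ends: "0 < \<alpha> \<Longrightarrow> s 0 < g - 1" "0 < \<delta> \<Longrightarrow> s (m - 1) < m - 2 - g"
  shows "hits_all_SHP m (chord_set m 0 s)"
proof (rule ccontr)
  define B where "B = chord_set m 0 s"
  assume "\<not> hits_all_SHP m (chord_set m 0 s)"
  then obtain p where p: "is_SHP m p" "path_avoids p B" unfolding B_def by (rule not_hits_imp_path)
  note p' = is_SHP_rev[OF p(1)] path_avoids_rev[OF p(2)]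
  define N where "N = nat (npts m)"
  have N: "int N = npts m" using npts_ge_3[OF m] by (simp add: N_def)
  have B: "B \<subseteq> edges m" using chord_in_edges s by (auto simp: B_def chord_set_def)
  have leaf: "chord m t (s t) \<in> B" if "0 \<le> t" "t < m" for t using that by (auto simp: B_def chord_set_def)
  have spine: "edge m t (t + 1) \<in> B" if "\<alpha> \<le> t" "t < m - \<delta>" "t \<noteq> g" for t
    using leaf[of t] zero[of t] that \<alpha>\<delta> by (simp add: boundary_edge_chord)
  have not_gap: "q ! 0 \<noteq> g mod npts m" "q ! 0 \<noteq> (g + 1) mod npts m"
    if "is_SHP m q" "path_avoids q B" for q
  proof -
    have l: "edge m t (t + 1) \<in> B" if "g - (g - \<alpha>) \<le> t" "t < g" for t using spine[of t] that gap by auto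
    have r: "edge m t (t + 1) \<in> B" if "g + 1 \<le> t" "t < g + 1 + (m - \<delta> - g - 1)" for t
      using spine[of t] that gap by auto
    have c: "chord m g (s g) \<in> B" using leaf[of g] gap \<alpha>\<delta> by auto
    have "s g \<le> m - 2" using s[of g] gap \<alpha>\<delta> by auto
    then show "q ! 0 \<noteq> g mod npts m" "q ! 0 \<noteq> (g + 1) mod npts m"
      using no_start_in_gap[where \<beta> = "g - \<alpha>" and \<gamma> = "m - \<delta> - g - 1",
          OF m that l r gap(1) _ _ _ c] gap by auto
  qed
  have inner: "t mod npts m \<noteq> p ! 0 \<and> t mod npts m \<noteq> p ! (nat (npts m) - 1)"
    if "\<alpha> < t" "t < m - \<delta>" for t
  proof (cases "t = g \<or> t = g + 1")
    case True
    then show ?thesis using not_gap[OF p] not_gap[OF p'] last_eq_rev_first[OF m p(1)] by auto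
  next
    case False
    then show ?thesis
      using spine_interior_not_start[OF m p, of t] last_eq_rev_first[OF m p(1)]
        spine_interior_not_start[OF m p', of t] spine[of t] spine[of "t - 1"] that by auto
  qed
  obtain h where h: "walk h" "avoids m h B" "h 0 < \<alpha>" "m - \<delta> \<le> h N"
    using spine_on_right_side[OF m p inner] unfolding N_def by blast
  obtain k where k: "k < N" "h k = g - 1" "h (Suc k) = g"
    using walk_reaches[OF h(1), of g N] h(3,4) gap by auto
  obtain l where l: "l < N" "h l = g" "h (Suc l) = g + 1"
    using walk_reaches[OF h(1), of "g + 1" N] h(3,4) gap by auto
  have "k \<noteq> 0" using k h(3) gap by (cases k) auto
  then obtain i where i: "k = Suc i" by (cases k) auto
  \<comment> \<open>Two right moves would use the last edge of the left spine. So the walk already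
    waits at \<open>g - 1\<close> one step before \<open>k\<close>, and the bound taken there is
    stronger by one.\<close>
  have "h i = g - 1"
  proof (rule ccontr)
    assume "h i \<noteq> g - 1"
    then have "h i = g - 2" using walkD[OF h(1), of i] k i by auto
    moreover have "edge m (g - 1) g \<in> B" using spine[of "g - 1"] gap by auto
    ultimately show False using avoidsD(1)[OF h(2), of i] k i N by simp
  qed
  have "2 * h i - int i + 1 \<le> 2 * 0"
    by (rule spine_sum_bound[OF h(1,2) N h(3), where s = s and M = g])
      (use h(4) leaf spine dec left k i \<open>h i = g - 1\<close> \<alpha>\<delta> gap ends in auto)
  moreover have "k < l"
  proof (rule ccontr)
    assume "\<not> k < l"
    then show False using walk_mono(1)[OF h(1), of l k] k l by simp
  qed
  moreover have l': "Suc l < N"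
  proof -
    have "Suc l \<noteq> N" using l h(4) gap by auto
    then show ?thesis using l by simp
  qed
  have "h (Suc (Suc l)) = g + 1"
    using avoidsD(1)[OF h(2), of l] walkD[OF h(1), of "Suc l"] spine[of "g + 1"] l l' N gap
    by (auto simp: add.commute)
  moreover have "\<delta> = 0 \<or> g + 1 \<le> m - 2 - s (m - 1)" using ends(2) \<alpha>\<delta>(2) by linarith
  then have "int (Suc (Suc l)) \<le> 2 * h (Suc (Suc l))"
    using h(3) leaf spine inc right l' \<open>h (Suc (Suc l)) = g + 1\<close> \<alpha>\<delta> gap
    by (intro reflected_spine_sum_bound[OF B h(1,2) N h(4) _ \<alpha>\<delta>(2), where s = s and M = "g + 1"]) auto
  ultimately show False using \<open>h i = g - 1\<close> i by simp
qed

section \<open>Reading the two classes as chord sets\<close>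

lemma classA_is_blocker:
  assumes "m \<ge> 2" "C \<in> classA m"
  shows "is_blocker m C"
proof -
  obtain \<alpha> \<delta> \<epsilon> \<xi> where c: "0 \<le> \<alpha>" "0 \<le> \<delta>" "\<alpha> + \<delta> \<le> m - 2"
    and \<epsilon>: "\<And>i. 1 \<le> i \<Longrightarrow> i < \<alpha> \<Longrightarrow> \<epsilon> i > \<epsilon> (i + 1)"
      "\<And>i. 1 \<le> i \<Longrightarrow> i \<le> \<alpha> \<Longrightarrow> 0 < \<epsilon> i \<and> \<alpha> - i + 1 \<le> \<epsilon> i \<and> \<epsilon> i \<le> m - \<delta> - i - 1"
    and \<xi>: "\<And>j. 1 \<le> j \<Longrightarrow> j < \<delta> \<Longrightarrow> \<xi> j > \<xi> (j + 1)"
      "\<And>j. 1 \<le> j \<Longrightarrow> j \<le> \<delta> \<Longrightarrow> 0 < \<xi> j \<and> \<delta> + 1 - j \<le> \<xi> j \<and> \<xi> j \<le> m - j - \<alpha> - 1"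
    and ends: "0 < \<alpha> \<Longrightarrow> 0 < \<delta> \<Longrightarrow> \<epsilon> 1 + \<xi> 1 \<le> m - 2"
    and C: "C = bpath m \<alpha> (m - \<delta>)
         \<union> {edge m (i - 1 - \<epsilon> i) (i + \<epsilon> i) | i. 1 \<le> i \<and> i \<le> \<alpha>}
         \<union> {edge m (m - j - \<xi> j) (m - j + 1 + \<xi> j) | j. 1 \<le> j \<and> j \<le> \<delta>}"
    using assms(2) unfolding classA_def by blast
  \<comment> \<open>Merges the two families of heights into one function of \<open>t\<close> by the
    shifts \<open>i = t + 1\<close> and \<open>j = m - t\<close>, with height 0 on the boundary
    path.\<close>
  define s where "s t = (if t < \<alpha> then \<epsilon> (t + 1) else if t < m - \<delta> then 0 else \<xi> (m - t))" for t
  have sub: "s (i - 1) = \<epsilon> i" if "i \<le> \<alpha>" for i using that by (simp add: s_def)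
  have sub': "s (m - j) = \<xi> j" if "j \<le> \<delta>" for j using that c by (simp add: s_def)
  have "C = chord_set m 0 s"
  proof -
    have "{edge m (i - 1 - \<epsilon> i) (i + \<epsilon> i) | i. 1 \<le> i \<and> i \<le> \<alpha>} =
        {edge m (i - 1 - s (i - 1)) (i + s (i - 1)) | i. 1 \<le> i \<and> i \<le> \<alpha>}"
      unfolding setcompr_eq_image by (intro image_cong) (simp_all add: sub)
    moreover have "{edge m (m - j - \<xi> j) (m - j + 1 + \<xi> j) | j. 1 \<le> j \<and> j \<le> \<delta>} =
        {edge m (m - j - s (m - j)) (m - j + 1 + s (m - j)) | j. 1 \<le> j \<and> j \<le> \<delta>}"
      unfolding setcompr_eq_image by (intro image_cong) (simp_all add: sub')
    moreover have "{chord m t (s t) | t. \<alpha> \<le> t \<and> t < m - \<delta>} = bpath m \<alpha> (m - \<delta>)"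
      by (rule chords_zero) (simp add: s_def)
    ultimately show ?thesis
      using chord_set_split[of \<alpha> m \<delta> s] c unfolding C by simp
  qed
  moreover have s: "0 \<le> s t \<and> s t \<le> m - 2" if "0 \<le> t" "t < m" for t
    using \<epsilon>(2)[of "t + 1"] \<xi>(2)[of "m - t"] c that assms(1) by (auto simp: s_def)
  moreover have "hits_all_SHP m (chord_set m 0 s)"
  proof (rule valley_hits_all_SHP[OF assms(1) c s])
    show "s (t + 1) < s t" if "0 \<le> t" "t + 1 < \<alpha>" for t
      using \<epsilon>(1)[of "t + 1"] that by (simp add: s_def)
    show "s t < s (t + 1)" if "m - \<delta> \<le> t" "t + 1 < m" for t
      using \<xi>(1)[of "m - t - 1"] that c by (simp add: s_def diff_diff_eq)
    show "0 < s t" if "0 \<le> t" "t < \<alpha>" for t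
      using \<epsilon>(2)[of "t + 1"] that by (simp add: s_def)
    show "0 < s t" if "m - \<delta> \<le> t" "t < m" for t
      using \<xi>(2)[of "m - t"] that c by (simp add: s_def)
    show "\<alpha> \<le> s 0" using \<epsilon>(2)[of 1] c by (auto simp: s_def)
    show "\<delta> \<le> s (m - 1)" using \<xi>(2)[of 1] c by (auto simp: s_def)
    show "s 0 + s (m - 1) \<le> m - 2"
      using \<epsilon>(2)[of 1] \<xi>(2)[of 1] ends c by (cases "\<alpha> = 0"; cases "\<delta> = 0") (auto simp: s_def)
  qed (auto simp: s_def)
  ultimately show ?thesis using chord_set_is_blocker[OF assms(1), of s] by blast
qed

lemma classB_is_blocker:
  assumes "m \<ge> 2" "C \<in> classB m"
  shows "is_blocker m C"
proof -
  obtain \<alpha> \<delta> \<beta> \<gamma> \<eta> \<epsilon> \<xi> where c: "0 \<le> \<alpha>" "0 \<le> \<delta>" "2 \<le> \<beta>" "2 \<le> \<gamma>" "\<beta> + \<gamma> = m - \<alpha> - \<delta> - 1"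
      "1 \<le> \<eta>" "\<eta> \<le> min (\<beta> - 1) (\<gamma> - 1)"
    and \<epsilon>: "\<And>i. 1 \<le> i \<Longrightarrow> i < \<alpha> \<Longrightarrow> \<epsilon> i > \<epsilon> (i + 1)"
      "\<And>i. 1 \<le> i \<Longrightarrow> i \<le> \<alpha> \<Longrightarrow> 0 < \<epsilon> i \<and> \<epsilon> i < \<alpha> + \<beta> - 1"
    and \<xi>: "\<And>j. 1 \<le> j \<Longrightarrow> j < \<delta> \<Longrightarrow> \<xi> j > \<xi> (j + 1)"
      "\<And>j. 1 \<le> j \<Longrightarrow> j \<le> \<delta> \<Longrightarrow> 0 < \<xi> j \<and> \<xi> j < \<gamma> + \<delta> - 1"
    and C: "C = bpath m \<alpha> (\<alpha> + \<beta>) \<union> bpath m (\<alpha> + \<beta> + 1) (m - \<delta>)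
         \<union> {edge m (\<alpha> + \<beta> - \<eta>) (\<alpha> + \<beta> + 1 + \<eta>)}
         \<union> {edge m (i - 1 - \<epsilon> i) (i + \<epsilon> i) | i. 1 \<le> i \<and> i \<le> \<alpha>}
         \<union> {edge m (m - j - \<xi> j) (m - j + 1 + \<xi> j) | j. 1 \<le> j \<and> j \<le> \<delta>}"
    using assms(2) unfolding classB_def by blast
  define g where "g = \<alpha> + \<beta>"
  define s where "s t = (if t < \<alpha> then \<epsilon> (t + 1) else if t < m - \<delta> then if t = g then \<eta> else 0
    else \<xi> (m - t))" for t
  have g: "\<alpha> \<le> g" "g < m - \<delta>" "s g = \<eta>" using c by (auto simp: g_def s_def)
  have sub: "s (i - 1) = \<epsilon> i" if "i \<le> \<alpha>" for i using that by (simp add: s_def)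
  have sub': "s (m - j) = \<xi> j" if "j \<le> \<delta>" for j using that c by (simp add: s_def)
  have "C = chord_set m 0 s"
  proof -
    have "{edge m (i - 1 - \<epsilon> i) (i + \<epsilon> i) | i. 1 \<le> i \<and> i \<le> \<alpha>} =
        {edge m (i - 1 - s (i - 1)) (i + s (i - 1)) | i. 1 \<le> i \<and> i \<le> \<alpha>}"
      unfolding setcompr_eq_image by (intro image_cong) (simp_all add: sub)
    moreover have "{edge m (m - j - \<xi> j) (m - j + 1 + \<xi> j) | j. 1 \<le> j \<and> j \<le> \<delta>} =
        {edge m (m - j - s (m - j)) (m - j + 1 + s (m - j)) | j. 1 \<le> j \<and> j \<le> \<delta>}"
      unfolding setcompr_eq_image by (intro image_cong) (simp_all add: sub')
    moreover have "{chord m t (s t) | t. \<alpha> \<le> t \<and> t < m - \<delta>} =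
        bpath m \<alpha> g \<union> bpath m (g + 1) (m - \<delta>) \<union> {edge m (g - s g) (g + 1 + s g)}"
      by (rule chords_one_nonzero) (use g in \<open>auto simp: s_def\<close>)
    ultimately show ?thesis
      using chord_set_split[of \<alpha> m \<delta> s] c unfolding C g_def[symmetric] g(3) by simp
  qed
  moreover have s: "0 \<le> s t \<and> s t \<le> m - 2" if "0 \<le> t" "t < m" for t
    using \<epsilon>(2)[of "t + 1"] \<xi>(2)[of "m - t"] c that assms(1) by (auto simp: s_def)
  moreover have "hits_all_SHP m (chord_set m 0 s)"
  proof (rule double_valley_hits_all_SHP[OF assms(1) c(1,2) s, where g = g])
    show "s (t + 1) < s t" if "0 \<le> t" "t + 1 < \<alpha>" for t
      using \<epsilon>(1)[of "t + 1"] that by (simp add: s_def)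
    show "s t < s (t + 1)" if "m - \<delta> \<le> t" "t + 1 < m" for t
      using \<xi>(1)[of "m - t - 1"] that c by (simp add: s_def diff_diff_eq)
    show "0 < s t" if "0 \<le> t" "t < \<alpha>" for t
      using \<epsilon>(2)[of "t + 1"] that by (simp add: s_def)
    show "0 < s t" if "m - \<delta> \<le> t" "t < m" for t
      using \<xi>(2)[of "m - t"] that c by (simp add: s_def)
    show "s 0 < g - 1" if "0 < \<alpha>" using \<epsilon>(2)[of 1] that by (auto simp: s_def g_def)
    show "s (m - 1) < m - 2 - g" if "0 < \<delta>" using \<xi>(2)[of 1] that c by (auto simp: s_def g_def)
    show "1 \<le> s g" "\<alpha> + s g < g" "g + s g + 1 < m - \<delta>" using c g by (auto simp: g_def)
  qed (auto simp: s_def)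
  ultimately show ?thesis using chord_set_is_blocker[OF assms(1), of s] by blast
qed

text \<open>The case \<open>\<alpha> = \<delta> = 0\<close>. It supplies a hitting set with
  \<open>m\<close> edges, so the lower bound is attained.\<close>

lemma boundary_path_in_classA:
  assumes "m \<ge> 2"
  shows "bpath m 0 m \<in> classA m"
  unfolding classA_def using assms
  by (intro CollectI exI[of _ 0] exI[of _ "\<lambda>_. 0"]) auto

theorem mainTheorem1:
  fixes m :: int
  assumes "m \<ge> 2"
  shows "(\<forall>B. is_blocker m B \<longrightarrow>
            card B = nat m \<and> card (direction m ` B) = nat m \<and>
            (\<exists>a. direction m ` B = {(2 * a + 2 * t + 1) mod npts m | t. 0 \<le> t \<and> t < m}) \<and>
            (\<exists>k. 0 \<le> k \<and> k \<le> 2 * m - 2 \<and>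
               (\<exists>C \<in> classA m \<union> classB m. B = rotate_edges m k C)))
       \<and> (\<forall>C \<in> classA m \<union> classB m. is_blocker m C)"
proof (intro conjI allI impI ballI)
  fix C assume "C \<in> classA m \<union> classB m"
  then show "is_blocker m C" using classA_is_blocker classB_is_blocker assms by blast
next
  fix B assume B: "is_blocker m B"
  then have B': "B \<subseteq> edges m" "hits_all_SHP m B" by (auto simp: is_blocker_def)
  have path: "is_blocker m (bpath m 0 m)"
    using classA_is_blocker boundary_path_in_classA assms by blast
  have "bpath m 0 m = (\<lambda>t. edge m t (t + 1)) ` {0..<m}" by (auto simp: bpath_def)
  then have "card (bpath m 0 m) \<le> nat m" using card_image_le[of "{0..<m}"] by simp
  then show cardB: "card B = nat m"
    using hitting_set_card(1)[OF assms B'] B path unfolding is_blocker_def by (meson le_antisym le_trans)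
  show cardD: "card (direction m ` B) = nat m" by (rule hitting_set_card(2)[OF assms B' cardB])
  show dir: "\<exists>a. direction m ` B = {(2 * a + 2 * t + 1) mod npts m | t. 0 \<le> t \<and> t < m}"
    by (rule hitting_set_card(3)[OF assms B' cardB])
  then obtain a where a: "direction m ` B = {(2 * a + 2 * t + 1) mod npts m | t. 0 \<le> t \<and> t < m}" by blast
  \<comment> \<open>The directions depend only on \<open>a\<close> modulo \<open>n\<close>; reducing
    \<open>a\<close> brings the rotation into the required range.\<close>
  define k where "k = a mod npts m"
  have "(2 * k + 2 * t + 1) mod npts m = (2 * a + 2 * t + 1) mod npts m" for t
    unfolding k_def by (metis (no_types, opaque_lifting) mod_add_left_eq mod_mult_right_eq)
  then have k: "direction m ` B = {(2 * k + 2 * t + 1) mod npts m | t. 0 \<le> t \<and> t < m}" using a by simp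
  obtain s where s: "\<And>t. 0 \<le> t \<Longrightarrow> t < m \<Longrightarrow> 0 \<le> s t \<and> s t \<le> m - 2" "B = chord_set m k s"
    using directions_imp_chord_set[OF assms B'(1) cardB cardD k] by blast
  note hits = B'(2)[unfolded s(2)]
  have "chord_set m 0 s \<in> classA m \<union> classB m"
    using assms s(1) another_boundary_edge[OF assms hits s(1)] descent_forces_zero[OF assms hits s(1)]
      ascent_forces_zero[OF assms hits s(1)] outer_chords_bound[OF assms hits s(1)]
      interior_nonzero_unique[OF assms hits s(1)]
    by (rule chord_set_in_classes)
  moreover have "0 \<le> k" "k < npts m" using npts_ge_3[OF assms] by (simp_all add: k_def)
  then have "0 \<le> k" "k \<le> 2 * m - 2" by (simp_all add: npts_def)
  ultimately show "\<exists>k. 0 \<le> k \<and> k \<le> 2 * m - 2 \<and> (\<exists>C \<in> classA m \<union> classB m. B = rotate_edges m k C)"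
    using rotate_chord_set[of m k s] s(2) by metis
qed

end
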